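(* Let $\mathbb{K}$ be an algebraically closed field of characteristic zero. Then, as $d\to\infty$, \[ \operatorname{r_{max}}(3,d)=\frac{d^2}{4}+O(d). \]
   Context: The (Waring) rank $\operatorname{rk} f$ of a homogeneous polynomial $f$ of degree $d>0$ over $\mathbb{K}$ is the least of the numbers $r$ such that $f$ can be written as a sum of $r$ $d$th powers of linear forms over $\mathbb{K}$. For positive integers $n,d$, $\operatorname{r_{max}}(n,d)$ denotes the maximum of $\operatorname{rk} f$ over all homogeneous polynomials $f$ of degree $d$ in $n$ indeterminates with coefficients in $\mathbb{K}$. *)

theory Defs
  imports
    Complex_Main
    "HOL-Library.Poly_Mapping"
    "HOL-Library.Landau_Symbols"
    "HOL-Computational_Algebra.Polynomial"
begin

text \<open>
  A polynomial is a finitely supported map from monomials to coefficients, a monomial being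
  a finitely supported map from indices of indeterminates to exponents. Addition,
  multiplication and powers are those of the ring instance (convolution) of
  \<^theory>\<open>HOL-Library.Poly_Mapping\<close>.
\<close>

type_synonym 'k mpoly = "(nat \<Rightarrow>\<^sub>0 nat) \<Rightarrow>\<^sub>0 'k"

text \<open>
  Homogeneous polynomials of degree \<open>d\<close> in the indeterminates with indices \<open>0, \<dots>, n - 1\<close>.
  The zero polynomial is homogeneous of every degree, so each of these sets is a vector space;
  linear forms are the case \<open>d = 1\<close>.
\<close>

definition forms :: "nat \<Rightarrow> nat \<Rightarrow> 'k::zero mpoly set" where
  "forms n d = {f. \<forall>m \<in> Poly_Mapping.keys f.
     Poly_Mapping.keys m \<subseteq> {..<n} \<and> (\<Sum>i<n. Poly_Mapping.lookup m i) = d}"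

text \<open>
  The rank is meaningful for \<open>d > 0\<close> and \<open>f \<in> forms n d\<close>. Over an algebraically closed field of
  characteristic zero every such \<open>f\<close> is a sum of \<open>d\<close>th powers of linear forms. The rank of the
  zero form is \<open>0\<close> (empty sum).
\<close>

definition waring_rank :: "nat \<Rightarrow> nat \<Rightarrow> 'k::comm_ring_1 mpoly \<Rightarrow> nat" where
  "waring_rank n d f =
     (LEAST r. \<exists>l :: nat \<Rightarrow> 'k mpoly. (\<forall>i<r. l i \<in> forms n 1) \<and> f = (\<Sum>i<r. l i ^ d))"

text \<open>
  The ranks of the forms of degree \<open>d > 0\<close> are bounded over such a field, by the dimension of
  the space of forms, so the maximum exists. The first argument selects the field.
\<close>

definition r_max :: "'k::comm_ring_1 itself \<Rightarrow> nat \<Rightarrow> nat \<Rightarrow> nat" where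
  "r_max _ n d = Max (waring_rank n d ` (forms n d :: 'k mpoly set))"

end

theory Submission
  imports Defs
begin

text \<open>
  Lower bound: let \<open>x y\<^sup>b z\<^sup>c\<close> with \<open>b + c = d - 1\<close> be a sum of \<open>r\<close> powers, and consider those of
  the corresponding points that lie off the line \<open>x = 0\<close>. If \<open>r < (b + 1)(c + 1)\<close>, some nonzero combination of the
  \<open>y\<^sup>i z\<^sup>j\<close> with \<open>i \<le> b\<close>, \<open>j \<le> c\<close> vanishes at all of them; multiplying it by the monomial that
  takes one of its top degree terms to \<open>y\<^sup>b z\<^sup>c\<close> contradicts the fact that evaluation at these
  points computes the coefficient of \<open>y\<^sup>b z\<^sup>c\<close>.

  Upper bound: dually, a ternary form of degree \<open>d\<close> is a functional on polynomials of degree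
  at most \<open>d\<close> in two variables, to be written with few evaluations. Substituting
  \<open>(x + y, x y)\<close> turns these polynomials into symmetric polynomials of degree at most \<open>d\<close> in
  each of \<open>x\<close> and \<open>y\<close>, and makes the tangent lines of a parabola into the lines \<open>x = s\<^sub>j\<close>. The
  functional is a combination of evaluations at the points \<open>(s\<^sub>i, s\<^sub>j)\<close>, \<open>i \<le> j \<le> d\<close>, in which the lines
  meet each other or the parabola. The lines are cleared one after the other. On the line of
  index \<open>j\<close> the weights at the points on the lines of index at most \<open>j\<close> are traded for about
  \<open>j / 2\<close> new points of the line, at the price of changing the weights at the points on the later
  lines. This is possible with \<open>j / 2 + O(1)\<close> points, the number for a generic binary form of
  degree \<open>j\<close>, as long as a certain Hankel form is nondegenerate; each change of a weight only
  has to avoid one bad value to preserve this for the later lines, and there is enough freedom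
  for that. Summing over \<open>j\<close> gives \<open>d\<^sup>2 / 4 + O(d)\<close>.
\<close>

subsection \<open>Linear functionals on polynomials\<close>

definition functional :: "('k::field poly \<Rightarrow> 'k) \<Rightarrow> bool" where
  "functional \<phi> \<longleftrightarrow> (\<forall>p q. \<phi> (p + q) = \<phi> p + \<phi> q) \<and> (\<forall>c p. \<phi> (smult c p) = c * \<phi> p)"

lemma functionalI:
  assumes "\<And>p q. \<phi> (p + q) = \<phi> p + \<phi> q" "\<And>c p. \<phi> (smult c p) = c * \<phi> p"
  shows "functional \<phi>"
  using assms by (simp add: functional_def)

lemma functional_add: "functional \<phi> \<Longrightarrow> \<phi> (p + q) = \<phi> p + \<phi> q"
  and functional_smult: "functional \<phi> \<Longrightarrow> \<phi> (smult c p) = c * \<phi> p"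
  by (simp_all add: functional_def)

lemma functional_0: "functional \<phi> \<Longrightarrow> \<phi> 0 = 0"
  using functional_smult[of \<phi> 0 0] by simp

lemma functional_diff: "functional \<phi> \<Longrightarrow> \<phi> (p - q) = \<phi> p - \<phi> q"
  by (metis add_diff_cancel_right' diff_add_cancel functional_add)

lemma functional_sum: "functional \<phi> \<Longrightarrow> \<phi> (\<Sum>x\<in>A. f x) = (\<Sum>x\<in>A. \<phi> (f x))"
  by (induction A rule: infinite_finite_induct) (simp_all add: functional_0 functional_add)

lemma functional_eval: "functional (\<lambda>p. poly p x)"
  by (simp add: functional_def)

lemma functional_coeff: "functional (\<lambda>p. coeff p n)"
  by (simp add: functional_def)

lemma functional_mult_left: "functional \<phi> \<Longrightarrow> functional (\<lambda>p. \<phi> (q * p))"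
  by (simp add: functional_def distrib_left)

lemma functional_minus: "functional \<phi> \<Longrightarrow> functional \<psi> \<Longrightarrow> functional (\<lambda>p. \<phi> p - \<psi> p)"
  by (simp add: functional_def algebra_simps)

lemma functional_scale: "functional \<phi> \<Longrightarrow> functional (\<lambda>p. c * \<phi> p)"
  by (simp add: functional_def algebra_simps)

text \<open>Induction on \<open>k\<close>: on the kernel of \<open>f k\<close> the functional is a
  combination of the earlier ones; subtracting it leaves a functional that vanishes on this kernel,
  hence is a multiple of \<open>f k\<close> on \<open>U\<close>.\<close>

lemma functional_in_span:
  fixes f :: "nat \<Rightarrow> 'k::field poly \<Rightarrow> 'k"
  assumes "\<And>p q. p \<in> U \<Longrightarrow> q \<in> U \<Longrightarrow> p + q \<in> U" "\<And>c p. p \<in> U \<Longrightarrow> smult c p \<in> U"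
    and "\<And>i. i < k \<Longrightarrow> functional (f i)" "functional \<phi>"
    and "\<And>p. p \<in> U \<Longrightarrow> (\<And>i. i < k \<Longrightarrow> f i p = 0) \<Longrightarrow> \<phi> p = 0"
  shows "\<exists>r. \<forall>p\<in>U. \<phi> p = (\<Sum>i<k. r i * f i p)"
  using assms
proof (induction k arbitrary: U)
  case 0
  then show ?case by simp
next
  case (Suc k)
  define U' where "U' = {p \<in> U. f k p = 0}"
  have fk: "functional (f k)" using Suc.prems(3) by blast
  have "\<exists>r. \<forall>p\<in>U'. \<phi> p = (\<Sum>i<k. r i * f i p)"
  proof (rule Suc.IH)
    show "p + q \<in> U'" if "p \<in> U'" "q \<in> U'" for p q
      using that Suc.prems(1) fk by (simp add: U'_def functional_add)
    show "smult c p \<in> U'" if "p \<in> U'" for c p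
      using that Suc.prems(2) fk by (simp add: U'_def functional_smult)
    show "\<phi> p = 0" if "p \<in> U'" "\<And>i. i < k \<Longrightarrow> f i p = 0" for p
      using that by (intro Suc.prems(5)) (auto simp: U'_def less_Suc_eq)
  qed (use Suc.prems in auto)
  then obtain r where r: "\<And>p. p \<in> U' \<Longrightarrow> \<phi> p = (\<Sum>i<k. r i * f i p)" by blast
  define \<mu> where "\<mu> p = \<phi> p - (\<Sum>i<k. r i * f i p)" for p
  have f: "functional (f i)" if "i < k" for i using Suc.prems(3) that by auto
  have \<mu>: "functional \<mu>"
    by (rule functionalI)
      (simp_all add: \<mu>_def functional_add[OF Suc.prems(4)] functional_smult[OF Suc.prems(4)]
        functional_add[OF f] functional_smult[OF f] algebra_simps sum.distrib sum_distrib_left)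
  have "\<exists>c. \<forall>p\<in>U. \<mu> p = c * f k p"
  proof (cases "\<exists>q\<in>U. f k q \<noteq> 0")
    case True
    then obtain q where q: "q \<in> U" "f k q \<noteq> 0" by blast
    have "\<mu> p = \<mu> q / f k q * f k p" if "p \<in> U" for p
    proof -
      define p' where "p' = p - smult (f k p / f k q) q"
      have "p' \<in> U"
        using Suc.prems(1)[OF that Suc.prems(2)[OF q(1), of "- (f k p / f k q)"]]
        by (simp add: p'_def)
      then have "p' \<in> U'"
        using q fk by (simp add: U'_def p'_def functional_diff functional_smult)
      then have "\<mu> p' = 0" using r by (simp add: \<mu>_def)
      then show ?thesis
        using \<mu> by (simp add: p'_def functional_diff functional_smult)
    qed
    then show ?thesis by blast
  next
    case False
    then have "\<mu> p = 0 * f k p" if "p \<in> U" for p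
      using r that by (simp add: U'_def \<mu>_def)
    then show ?thesis by blast
  qed
  then obtain c where "\<And>p. p \<in> U \<Longrightarrow> \<mu> p = c * f k p" by blast
  then have "\<forall>p\<in>U. \<phi> p = (\<Sum>i<Suc k. (r(k := c)) i * f i p)"
    by (auto simp: \<mu>_def algebra_simps)
  then show ?case by blast
qed

section \<open>Generic choices in vector spaces and pencils of polynomials\<close>

lemma finite_linear_roots:
  fixes a b :: "'k::field"
  assumes "a \<noteq> 0 \<or> b \<noteq> 0"
  shows "finite {t. a + t * b = 0}"
proof (cases "b = 0")
  case False
  have "t = - a / b" if "a + t * b = 0" for t
  proof -
    have "t * b = - a" using that by (simp add: eq_neg_iff_add_eq_0 add.commute)
    then show ?thesis using False by (metis nonzero_mult_div_cancel_right)
  qed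
  then have "{t. a + t * b = 0} \<subseteq> {- a / b}" by blast
  then show ?thesis by (rule finite_subset) simp
qed (use assms in simp)

text \<open>A vector space over an infinite field is not a finite union of proper subspaces: on the
  line \<open>p + smult t q\<close> each functional excludes at most one \<open>t\<close>.\<close>

lemma ex_functionals_nonzero:
  fixes V :: "'k::field_char_0 poly set"
  assumes "finite \<Lambda>" "V \<noteq> {}"
    and V: "\<And>p q. p \<in> V \<Longrightarrow> q \<in> V \<Longrightarrow> p + q \<in> V" "\<And>c p. p \<in> V \<Longrightarrow> smult c p \<in> V"
    and "\<And>\<phi>. \<phi> \<in> \<Lambda> \<Longrightarrow> functional \<phi> \<and> (\<exists>p\<in>V. \<phi> p \<noteq> 0)"
  shows "\<exists>p\<in>V. \<forall>\<phi>\<in>\<Lambda>. \<phi> p \<noteq> 0"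
  using assms(1,2,5)
proof (induction \<Lambda>)
  case empty
  then show ?case by blast
next
  case (insert \<phi> \<Lambda>)
  then obtain p where p: "p \<in> V" "\<And>\<psi>. \<psi> \<in> \<Lambda> \<Longrightarrow> \<psi> p \<noteq> 0" by auto
  obtain q where q: "q \<in> V" "\<phi> q \<noteq> 0" using insert.prems by blast
  have "finite {t. \<psi> p + t * \<psi> q = 0}" if "\<psi> \<in> insert \<phi> \<Lambda>" for \<psi>
    using that p q by (intro finite_linear_roots) auto
  then have "finite (\<Union>\<psi>\<in>insert \<phi> \<Lambda>. {t. \<psi> p + t * \<psi> q = 0})"
    using insert.hyps by blast
  then obtain t where "\<And>\<psi>. \<psi> \<in> insert \<phi> \<Lambda> \<Longrightarrow> \<psi> p + t * \<psi> q \<noteq> 0"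
    using ex_new_if_finite[OF infinite_UNIV_char_0] by blast
  moreover have "\<psi> (p + smult t q) = \<psi> p + t * \<psi> q" if "\<psi> \<in> insert \<phi> \<Lambda>" for \<psi>
    using insert.prems(2)[OF that] by (simp add: functional_add functional_smult)
  moreover have "p + smult t q \<in> V" using V p(1) q(1) by blast
  ultimately show ?case by (intro bexI[of _ "p + smult t q"]) auto
qed

text \<open>A multiple root of a member is a root of the Wronskian \<open>w\<close>, which leaves
  finitely many \<open>x\<close>; as \<open>p\<close> and \<open>q\<close> have no common root, each
  \<open>x\<close> is a root of at most one member.\<close>

lemma finite_not_rsquarefree_pencil:
  fixes p q :: "'k::{alg_closed_field,field_char_0} poly"
  assumes "degree p > 0" and coprime: "\<And>x. poly p x = 0 \<Longrightarrow> poly q x \<noteq> 0"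
  shows "finite {t. \<not> rsquarefree (p + smult t q)}"
proof -
  define w where "w = pderiv p * q - p * pderiv q"
  have "w \<noteq> 0"
  proof
    assume "w = 0"
    then have eq: "pderiv p * q = p * pderiv q" by (simp add: w_def)
    obtain x where x: "poly p x = 0" using alg_closed_imp_poly_has_root assms(1) by blast
    have "p \<noteq> 0" "pderiv p \<noteq> 0" using assms(1) by (auto simp: pderiv_eq_0_iff)
    moreover have "q \<noteq> 0" using coprime[OF x] by auto
    ultimately have nz: "pderiv p * q \<noteq> 0" by simp
    \<comment> \<open>At a root of \<open>p\<close>, where \<open>q\<close> is nonzero,
      \<open>pderiv p * q\<close> has smaller order than \<open>p\<close>, but
      \<open>p * pderiv q\<close> does not.\<close>
    have "order x (pderiv p * q) = order x (pderiv p)"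
      using nz coprime[OF x] by (simp add: order_mult order_0I)
    moreover have "order x (p * pderiv q) \<ge> order x p"
      using nz eq by (simp add: order_mult)
    moreover have "order x p = Suc (order x (pderiv p))"
      using \<open>p \<noteq> 0\<close> x \<open>pderiv p \<noteq> 0\<close> by (intro order_pderiv) (auto simp: order_root)
    ultimately show False using eq by simp
  qed
  have "{t. \<not> rsquarefree (p + smult t q)} \<subseteq>
      (\<Union>x\<in>{x. poly w x = 0}. {t. poly p x + t * poly q x = 0})"
  proof
    fix t assume "t \<in> {t. \<not> rsquarefree (p + smult t q)}"
    then obtain x where x: "poly p x + t * poly q x = 0"
        "poly (pderiv p) x + t * poly (pderiv q) x = 0"
      by (auto simp: rsquarefree_roots pderiv_add pderiv_smult)
    then have "poly p x = - t * poly q x" "poly (pderiv p) x = - t * poly (pderiv q) x"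
      by (simp_all add: eq_neg_iff_add_eq_0)
    then have "poly w x = 0" by (simp add: w_def)
    then show "t \<in> (\<Union>x\<in>{x. poly w x = 0}. {t. poly p x + t * poly q x = 0})"
      using x by blast
  qed
  moreover have "finite \<dots>"
    using \<open>w \<noteq> 0\<close> coprime by (intro finite_UN_I poly_roots_finite finite_linear_roots) auto
  ultimately show ?thesis by (rule finite_subset)
qed

section \<open>Nodal polynomials and Lagrange interpolation\<close>

definition nodal :: "'k::field set \<Rightarrow> 'k poly" where
  "nodal Z = (\<Prod>z\<in>Z. [:- z, 1:])"

lemma poly_nodal: "poly (nodal Z) x = (\<Prod>z\<in>Z. x - z)"
  by (simp add: nodal_def poly_prod)

lemma poly_nodal_eq_0_iff: "finite Z \<Longrightarrow> poly (nodal Z) x = 0 \<longleftrightarrow> x \<in> Z"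
  by (auto simp: poly_nodal)

lemma degree_nodal: "degree (nodal Z) = card Z"
  by (simp add: nodal_def degree_prod_sum_eq)

lemma nodal_nonzero: "nodal Z \<noteq> 0"
  by (cases "finite Z") (auto simp: nodal_def)

lemma nodal_union: "finite A \<Longrightarrow> finite B \<Longrightarrow> A \<inter> B = {} \<Longrightarrow> nodal (A \<union> B) = nodal A * nodal B"
  by (simp add: nodal_def prod.union_disjoint)

lemma nodal_remove: "finite Z \<Longrightarrow> z \<in> Z \<Longrightarrow> nodal Z = [:- z, 1:] * nodal (Z - {z})"
  by (simp add: nodal_def prod.remove)

text \<open>A linear factor occurring twice would give a common root of \<open>p\<close> and
  \<open>pderiv p\<close>, so the multiset of roots is a set.\<close>

lemma rsquarefree_eq_nodal:
  fixes p :: "'k::{alg_closed_field,field_char_0} poly"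
  assumes "rsquarefree p"
  shows "p = smult (lead_coeff p) (nodal {x. poly p x = 0})"
proof -
  have "p \<noteq> 0" using assms by (simp add: rsquarefree_def)
  then obtain A where A: "p = smult (lead_coeff p) (\<Prod>x\<in>#A. [:-x, 1:])"
    using alg_closed_imp_factorization by blast
  have "count A x \<le> 1" for x
  proof (rule ccontr)
    assume "\<not> count A x \<le> 1"
    then have "{#x, x#} \<subseteq># A"
      by (simp add: subseteq_mset_def)
    then obtain B where "A = {#x, x#} + B" by (metis subset_mset.le_iff_add)
    then have "p = [:-x, 1:] * ([:-x, 1:] * smult (lead_coeff p) (\<Prod>x\<in>#B. [:-x, 1:]))"
      using A by (simp add: mult.assoc)
    then obtain g where g: "p = [:-x, 1:] * ([:-x, 1:] * g)" by blast
    then have "poly p x = 0" "poly (pderiv p) x = 0"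
      by (simp_all only: pderiv_mult) simp_all
    then show False using assms rsquarefree_roots by blast
  qed
  then have "A = mset_set (set_mset A)"
    by (metis One_nat_def count_eq_zero_iff count_mset_set(1,3) finite_set_mset le_Suc_eq le_zero_eq
        multiset_eqI)
  moreover have "set_mset A = {x. poly p x = 0}"
  proof -
    have "poly p x = lead_coeff p * (\<Prod>y\<in>#A. x - y)" for x
      by (subst A) (simp add: poly_prod_mset image_mset.compositionality o_def)
    then show ?thesis using \<open>p \<noteq> 0\<close> by (auto simp: prod_mset_zero_iff)
  qed
  ultimately have "(\<Prod>x\<in>#A. [:-x, 1:]) = nodal {x. poly p x = 0}"
    by (metis nodal_def prod_unfold_prod_mset)
  then show ?thesis using A by simp
qed

definition lagrange :: "'k::field set \<Rightarrow> 'k \<Rightarrow> 'k poly" where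
  "lagrange Z z = smult (inverse (poly (nodal (Z - {z})) z)) (nodal (Z - {z}))"

lemma poly_lagrange:
  "finite Z \<Longrightarrow> z \<in> Z \<Longrightarrow> x \<in> Z \<Longrightarrow> poly (lagrange Z z) x = (if x = z then 1 else 0)"
  by (auto simp: lagrange_def poly_nodal_eq_0_iff)

lemma degree_lagrange: "finite Z \<Longrightarrow> z \<in> Z \<Longrightarrow> degree (lagrange Z z) < card Z"
  by (metis card_Diff1_less degree_nodal degree_smult_le lagrange_def order_le_less_trans)

lemma lagrange_interpolation:
  assumes Z: "finite Z" "Z \<noteq> {}" and "degree p < card Z"
  shows "p = (\<Sum>z\<in>Z. smult (poly p z) (lagrange Z z))"
proof (rule poly_eqI_degree)
  show "poly p x = poly (\<Sum>z\<in>Z. smult (poly p z) (lagrange Z z)) x" if "x \<in> Z" for x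
    using that Z by (simp add: poly_sum poly_lagrange if_distrib sum.delta cong: if_cong sum.cong)
  show "degree (\<Sum>z\<in>Z. smult (poly p z) (lagrange Z z)) < card Z"
    using Z by (intro degree_sum_less) (auto simp: card_gt_0_iff degree_lagrange
        intro!: le_less_trans[OF degree_smult_le])
qed (use assms in auto)

text \<open>Division by \<open>nodal Z\<close>: the multiple of \<open>nodal Z\<close> is killed by
  \<open>ker\<close>, and the remainder is interpolated at \<open>Z\<close>, where it agrees with
  \<open>p\<close>.\<close>

lemma functional_eq_sum_eval:
  assumes Z: "finite Z" "Z \<noteq> {}" and \<phi>: "functional \<phi>" and "degree p \<le> d"
    and ker: "\<And>g. g \<noteq> 0 \<Longrightarrow> degree g + card Z \<le> d \<Longrightarrow> \<phi> (nodal Z * g) = 0"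
  shows "\<phi> p = (\<Sum>z\<in>Z. \<phi> (lagrange Z z) * poly p z)"
proof -
  define g r where "g = p div nodal Z" and "r = p mod nodal Z"
  have p: "p = nodal Z * g + r" by (simp add: g_def r_def)
  have deg_r: "degree r < card Z"
    using degree_mod_less'[of "nodal Z" p] Z card_gt_0_iff[of Z]
    by (cases "r = 0") (auto simp: r_def nodal_nonzero degree_nodal)
  have "\<phi> (nodal Z * g) = 0"
  proof (cases "g = 0")
    case True
    then show ?thesis using \<phi> by (simp add: functional_0)
  next
    case False
    have "degree g + card Z = degree (nodal Z * g)"
      using False by (simp add: degree_mult_eq nodal_nonzero degree_nodal)
    also have "\<dots> = degree (p - r)" by (simp add: p)
    also have "\<dots> \<le> d"
    proof (cases "degree p < card Z")
      case True
      then have "g = 0" unfolding g_def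
        by (simp add: div_poly_less degree_nodal)
      then show ?thesis using False by simp
    next
      case False
      then show ?thesis using deg_r \<open>degree p \<le> d\<close> by (intro degree_diff_le) auto
    qed
    finally show ?thesis by (intro ker False)
  qed
  then have "\<phi> p = \<phi> r" using \<phi> by (simp add: p functional_add)
  also have "\<dots> = (\<Sum>z\<in>Z. poly r z * \<phi> (lagrange Z z))"
    by (subst lagrange_interpolation[OF Z deg_r])
      (simp add: functional_sum[OF \<phi>] functional_smult[OF \<phi>])
  also have "\<dots> = (\<Sum>z\<in>Z. \<phi> (lagrange Z z) * poly p z)"
    using Z by (intro sum.cong) (auto simp: p poly_nodal_eq_0_iff)
  finally show ?thesis .
qed

subsection \<open>Decompositions on one line\<close>

text \<open>
  The new points are the roots of a polynomial \<open>p\<close> of degree \<open>m\<close> apolar to the functional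
  \<open>\<phi> (nodal S * _)\<close>. All requirements on \<open>p\<close> except squarefreeness say that some linear functional
  does not vanish at \<open>p\<close>; by nondegeneracy none of these functionals vanishes on the whole
  space \<open>V\<close> of apolar polynomials. Squarefreeness holds for almost all members of a pencil
  without base points.
\<close>

lemma line_decomposition:
  fixes \<phi> :: "'k::{alg_closed_field,field_char_0} poly \<Rightarrow> 'k"
  assumes \<phi>: "functional \<phi>" and S: "finite S"
    and nondeg: "\<And>r. degree r \<le> n div 2 \<Longrightarrow>
      (\<And>p. degree p \<le> n div 2 \<Longrightarrow> \<phi> (nodal S * (r * p)) = 0) \<Longrightarrow> r = 0"
  shows "\<exists>T \<alpha> c. finite T \<and> card T = n + 1 - n div 2 \<and> (\<forall>q\<in>S. c q \<noteq> \<beta> q) \<and>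
    (\<forall>h. degree h \<le> n + card S \<longrightarrow>
      \<phi> h = (\<Sum>p\<in>T. \<alpha> p * poly h p) + (\<Sum>q\<in>S. c q * poly h q))"
proof -
  \<comment> \<open>Orthogonality to all polynomials of degree less than \<open>k\<close> is
    \<open>k\<close> conditions on the \<open>m + 1\<close> coefficients of \<open>p\<close>. As
    \<open>k < m\<close>, the solution space \<open>V\<close> has dimension at least 2, which leaves
    room for a pencil.\<close>
  define k where "k = n div 2"
  define m where "m = n + 1 - k"
  have km: "m + k = n + 1" "k < m" by (auto simp: k_def m_def)
  define \<psi> where "\<psi> p = \<phi> (nodal S * p)" for p
  have \<psi>: "functional \<psi>" unfolding \<psi>_def by (rule functional_mult_left[OF \<phi>])
  have nondeg': "r = 0" if "degree r \<le> k" "\<And>p. degree p \<le> k \<Longrightarrow> \<psi> (r * p) = 0" for r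
    using nondeg[of r] that by (simp add: k_def \<psi>_def)
  define V where "V = {p. degree p \<le> m \<and> (\<forall>i<k. \<psi> (monom 1 i * p) = 0)}"
  have V_add: "p + q \<in> V" if "p \<in> V" "q \<in> V" for p q
    using that by (auto simp: V_def degree_add_le distrib_left functional_add[OF \<psi>])
  have V_smult: "smult c p \<in> V" if "p \<in> V" for c p
    using that by (auto simp: V_def functional_smult[OF \<psi>] intro: order_trans[OF degree_smult_le])
  have "0 \<in> V" by (simp add: V_def functional_0[OF \<psi>])
  have \<psi>_sum: "\<psi> ((\<Sum>i<k. monom (r i) i) * p) = (\<Sum>i<k. r i * \<psi> (monom 1 i * p))" for r p
  proof -
    have "(\<Sum>i<k. monom (r i) i) * p = (\<Sum>i<k. smult (r i) (monom 1 i * p))"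
      by (simp add: sum_distrib_right smult_monom flip: mult_smult_left)
    then show ?thesis by (simp add: functional_sum[OF \<psi>] functional_smult[OF \<psi>])
  qed
  \<comment> \<open>\<open>V\<close> is cut out by the pairings with \<open>monom 1 i\<close>, so a
    functional vanishing on \<open>V\<close> is itself a pairing with some \<open>r\<close> of
    degree less than \<open>k\<close>. Each nonvanishing claim below refutes such an
    \<open>r\<close> by nondegeneracy.\<close>
  have represent: "\<exists>r. (r = 0 \<or> degree r < k) \<and> (\<forall>p. degree p \<le> m \<longrightarrow> \<chi> p = \<psi> (r * p))"
    if \<chi>: "functional \<chi>" "\<And>p. p \<in> V \<Longrightarrow> \<chi> p = 0" for \<chi>
  proof -
    have "\<exists>r. \<forall>p\<in>{p. degree p \<le> m}. \<chi> p = (\<Sum>i<k. r i * \<psi> (monom 1 i * p))"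
    proof (rule functional_in_span)
      show "\<chi> p = 0" if "p \<in> {p. degree p \<le> m}" "\<And>i. i < k \<Longrightarrow> \<psi> (monom 1 i * p) = 0" for p
        using that \<chi>(2) by (simp add: V_def)
    qed (auto intro: degree_add_le order_trans[OF degree_smult_le] functional_mult_left[OF \<psi>] \<chi>(1))
    then obtain r where r: "\<And>p. degree p \<le> m \<Longrightarrow> \<chi> p = (\<Sum>i<k. r i * \<psi> (monom 1 i * p))"
      by blast
    let ?r = "\<Sum>i<k. monom (r i) i"
    have "degree ?r < k" if "k > 0"
      using that by (intro degree_sum_less) (auto intro: le_less_trans[OF degree_monom_le])
    then have "?r = 0 \<or> degree ?r < k" by (cases "k = 0") auto
    then show ?thesis using r \<psi>_sum by (intro exI[of _ ?r]) simp
  qed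
  have V_coeff: "\<exists>p\<in>V. coeff p m \<noteq> 0"
  proof (rule ccontr)
    assume "\<not> (\<exists>p\<in>V. coeff p m \<noteq> 0)"
    then obtain r where r: "r = 0 \<or> degree r < k" "\<And>p. degree p \<le> m \<Longrightarrow> coeff p m = \<psi> (r * p)"
      using represent[OF functional_coeff[of m]] by auto
    have "\<psi> (r * p) = 0" if "degree p \<le> k" for p
    proof -
      have "degree p < m" using that km by linarith
      then show ?thesis using r(2)[of p] by (simp add: coeff_eq_0)
    qed
    then have "r = 0" using r(1) by (intro nondeg') auto
    then show False using r(2)[of "monom 1 m"] by (simp add: degree_monom_eq functional_0[OF \<psi>])
  qed
  have shift: "degree ([:- x, 1:] * p) \<le> m" if "degree p \<le> k" for p :: "'k poly" and x
    using that km degree_mult_le[of "[:- x, 1:]" p] by simp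
  have shift': "degree (r * [:- x, 1:]) \<le> k" if "r = 0 \<or> degree r < k" for r :: "'k poly" and x
    using that degree_mult_le[of r "[:- x, 1:]"] by auto
  have V_eval: "\<exists>p\<in>V. poly p x \<noteq> 0" for x
  proof (rule ccontr)
    assume "\<not> (\<exists>p\<in>V. poly p x \<noteq> 0)"
    then obtain r where r: "r = 0 \<or> degree r < k" "\<And>p. degree p \<le> m \<Longrightarrow> poly p x = \<psi> (r * p)"
      using represent[OF functional_eval[of x]] by auto
    have "\<psi> ((r * [:- x, 1:]) * p) = 0" if "degree p \<le> k" for p
      using r(2)[OF shift[OF that, of x]] by (simp only: mult.assoc) simp
    then have "r * [:- x, 1:] = 0" using r(1) by (intro nondeg' shift')
    then have "r = 0" by (simp only: mult_eq_0_iff) simp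
    then show False using r(2)[of 1] by (simp add: functional_0[OF \<psi>])
  qed
  \<comment> \<open>Cleared of denominators, the equation \<open>c q = \<beta> q\<close> for the
    Lagrange weight of \<open>q\<close> becomes \<open>\<chi> q (nodal T) = 0\<close>.\<close>
  define \<chi> where
    "\<chi> q p = \<phi> (nodal (S - {q}) * p) - \<beta> q * poly (nodal (S - {q})) q * poly p q" for q p
  have \<chi>: "functional (\<chi> q)" for q
    unfolding \<chi>_def
    by (intro functional_minus functional_mult_left[OF \<phi>] functional_scale functional_eval)
  have V_\<chi>: "\<exists>p\<in>V. \<chi> q p \<noteq> 0" if "q \<in> S" for q
  proof (rule ccontr)
    assume "\<not> (\<exists>p\<in>V. \<chi> q p \<noteq> 0)"
    then obtain r where r: "r = 0 \<or> degree r < k" "\<And>p. degree p \<le> m \<Longrightarrow> \<chi> q p = \<psi> (r * p)"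
      using represent[OF \<chi>[of q]] by auto
    \<comment> \<open>On multiples of \<open>[:- q, 1:]\<close> the functional
      \<open>\<chi> q\<close> reduces to \<open>\<psi>\<close> of the cofactor.\<close>
    have "\<psi> ((1 - r * [:- q, 1:]) * p) = 0" if "degree p \<le> k" for p
    proof -
      have "\<psi> (r * ([:- q, 1:] * p)) = \<chi> q ([:- q, 1:] * p)" using r(2)[OF shift[OF that]] by simp
      also have "\<dots> = \<psi> p"
        by (simp add: \<chi>_def \<psi>_def nodal_remove[OF S \<open>q \<in> S\<close>] mult_ac del: mult_pCons_left mult_pCons_right)
      finally show ?thesis
        by (simp add: left_diff_distrib functional_diff[OF \<psi>] mult.assoc
            del: mult_pCons_left mult_pCons_right)
    qed
    then have "1 - r * [:- q, 1:] = 0"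
      using shift'[OF r(1)] by (intro nondeg' degree_diff_le) auto
    then have "poly (1 - r * [:- q, 1:]) q = 0" by (simp only: poly_0)
    then show False by simp
  qed

  \<comment> \<open>Nonvanishing of these at \<open>p\<close> gives exact degree \<open>m\<close>,
    weights different from \<open>\<beta>\<close>, and roots outside \<open>S\<close>.\<close>
  define \<Lambda> where "\<Lambda> = insert (\<lambda>p. coeff p m) (\<chi> ` S \<union> (\<lambda>x p. poly p x) ` S)"
  have \<Lambda>: "finite \<Lambda>" "\<And>\<mu>. \<mu> \<in> \<Lambda> \<Longrightarrow> functional \<mu> \<and> (\<exists>p\<in>V. \<mu> p \<noteq> 0)"
    using S \<chi> V_coeff V_eval V_\<chi> by (auto simp: \<Lambda>_def functional_coeff functional_eval)
  obtain p0 where p0: "p0 \<in> V" "\<And>\<mu>. \<mu> \<in> \<Lambda> \<Longrightarrow> \<mu> p0 \<noteq> 0"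
    using ex_functionals_nonzero[OF \<Lambda>(1) _ V_add V_smult \<Lambda>(2)] \<open>0 \<in> V\<close> by blast
  have "coeff p0 m \<noteq> 0" using p0(2)[of "\<lambda>p. coeff p m"] by (simp add: \<Lambda>_def)
  then have deg_p0: "degree p0 > 0" using km le_degree[of p0 m] by auto
  then have "finite {x. poly p0 x = 0}" by (intro poly_roots_finite) auto
  then have "\<exists>p\<in>V. \<forall>\<mu>\<in>(\<lambda>x p. poly p x) ` {x. poly p0 x = 0}. \<mu> p \<noteq> 0"
    using V_eval \<open>0 \<in> V\<close>
    by (intro ex_functionals_nonzero V_add V_smult) (auto simp: functional_eval)
  then obtain p1 where p1: "p1 \<in> V" "\<And>x. poly p0 x = 0 \<Longrightarrow> poly p1 x \<noteq> 0" by auto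
  have "finite ({t. \<not> rsquarefree (p0 + smult t p1)} \<union> (\<Union>\<mu>\<in>\<Lambda>. {t. \<mu> p0 + t * \<mu> p1 = 0}))"
    using finite_not_rsquarefree_pencil[OF deg_p0 p1(2)] \<Lambda>(1) p0(2) finite_linear_roots by blast
  then obtain t where t: "rsquarefree (p0 + smult t p1)" "\<And>\<mu>. \<mu> \<in> \<Lambda> \<Longrightarrow> \<mu> p0 + t * \<mu> p1 \<noteq> 0"
    using ex_new_if_finite[OF infinite_UNIV_char_0] by blast
  define p where "p = p0 + smult t p1"
  have p: "p \<in> V" "rsquarefree p" "\<And>\<mu>. \<mu> \<in> \<Lambda> \<Longrightarrow> \<mu> p \<noteq> 0"
    using t V_add V_smult p0(1) p1(1) \<Lambda>(2) by (simp_all add: p_def functional_add functional_smult)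
  have "coeff p m \<noteq> 0" using p(3)[of "\<lambda>p. coeff p m"] by (simp add: \<Lambda>_def)
  then have deg_p: "degree p = m" using p(1) le_degree[of p m] by (simp add: V_def)
  define T where "T = {x. poly p x = 0}"
  have p_eq: "p = smult (lead_coeff p) (nodal T)"
    unfolding T_def by (rule rsquarefree_eq_nodal) fact
  have lc: "lead_coeff p \<noteq> 0" using p(2) by (auto simp: rsquarefree_def)
  have T: "finite T" "card T = m" "T \<inter> S = {}"
  proof -
    show "finite T" unfolding T_def using lc by (intro poly_roots_finite) auto
    show "card T = m" using deg_p lc p_eq by (metis degree_nodal degree_smult_eq)
    have "poly p q \<noteq> 0" if "q \<in> S" for q
      using p(3)[of "\<lambda>p. poly p q"] that by (simp add: \<Lambda>_def)
    then show "T \<inter> S = {}" by (auto simp: T_def)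
  qed
  define c where "c z = \<phi> (lagrange (T \<union> S) z)" for z
  have "\<phi> h = (\<Sum>z\<in>T. c z * poly h z) + (\<Sum>q\<in>S. c q * poly h q)" if "degree h \<le> n + card S" for h
  proof -
    have "\<phi> h = (\<Sum>z\<in>T \<union> S. \<phi> (lagrange (T \<union> S) z) * poly h z)"
    proof (rule functional_eq_sum_eval[OF _ _ \<phi> that])
      show "\<phi> (nodal (T \<union> S) * g) = 0" if "g \<noteq> 0" "degree g + card (T \<union> S) \<le> n + card S" for g
      proof -
        \<comment> \<open>\<open>card T = m = n + 1 - k\<close> leaves \<open>degree g < k\<close>,
          so the apolarity of \<open>p\<close>, a multiple of \<open>nodal T\<close>, applies to
          \<open>g\<close>.\<close>
        have "degree g < k" using that km T S by (simp add: card_Un_disjoint)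
        then have g: "g = (\<Sum>i<k. monom (coeff g i) i)"
          by (metis poly_as_sum_of_monoms' lessThan_Suc_atMost Suc_le_eq Suc_pred' less_Suc_eq_le
              gr_implies_not0 not_gr_zero)
        have "\<psi> (g * p) = 0" using p(1) by (subst g, subst \<psi>_sum) (simp add: V_def)
        then have "lead_coeff p * \<psi> (nodal T * g) = 0"
          by (subst (asm) p_eq) (simp add: functional_smult[OF \<psi>] mult.commute)
        then show ?thesis
          using lc nodal_union[OF T(1) S T(3)] by (simp add: \<psi>_def mult_ac)
      qed
      show "T \<union> S \<noteq> {}" using T km by auto
    qed (use T S in auto)
    then show ?thesis using T S by (simp add: c_def sum.union_disjoint)
  qed
  moreover have "c q \<noteq> \<beta> q" if "q \<in> S" for q
  proof
    assume "c q = \<beta> q"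
    have "T \<union> S - {q} = T \<union> (S - {q})" using T(3) that by blast
    then have N: "nodal (T \<union> S - {q}) = nodal T * nodal (S - {q})"
      using nodal_union[of T "S - {q}"] T S by auto
    have "poly (nodal (T \<union> S - {q})) q \<noteq> 0" using T S by (simp add: poly_nodal_eq_0_iff)
    then have "\<phi> (nodal T * nodal (S - {q})) = \<beta> q * (poly (nodal T) q * poly (nodal (S - {q})) q)"
      using \<open>c q = \<beta> q\<close> by (simp add: c_def lagrange_def functional_smult[OF \<phi>] N field_simps)
    then have "\<chi> q (nodal T) = 0" by (simp add: \<chi>_def mult_ac)
    then have "\<chi> q p = 0" by (subst p_eq) (simp add: functional_smult[OF \<chi>])
    then show False using p(3)[of "\<chi> q"] that by (simp add: \<Lambda>_def)
  qed
  ultimately show ?thesis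
    using T by (intro exI[of _ T] exI[of _ c]) (auto simp: m_def k_def)
qed

subsection \<open>Clearing the lines\<close>

text \<open>The functions of \<open>(x, y)\<close> that come from polynomials of degree at most \<open>d\<close> in \<open>(x + y, x y)\<close>.\<close>

definition sym_bidegree :: "nat \<Rightarrow> ('k::field \<Rightarrow> 'k \<Rightarrow> 'k) \<Rightarrow> bool" where
  "sym_bidegree d E \<longleftrightarrow>
     (\<forall>x y. E x y = E y x) \<and> (\<forall>x. \<exists>h. degree h \<le> d \<and> (\<forall>y. E x y = poly h y))"

text \<open>
  The weight \<open>U l j\<close>, \<open>l \<le> j\<close>, belongs to the point in which the lines \<open>l\<close> and \<open>j\<close> meet. After
  \<open>i\<close> lines have been cleared, the weights \<open>U l j\<close> with \<open>l < i\<close> have their final values, and so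
  does \<open>U j j\<close>; the remaining ones are left out of \<open>row_functional\<close> until they are final.
  The factor \<open>nodal (s ` {j<..d})\<close> kills the points whose weights may be changed when line \<open>j\<close>
  is cleared.
\<close>

definition row_functional ::
  "(nat \<Rightarrow> 'k::field) \<Rightarrow> nat \<Rightarrow> (nat \<Rightarrow> nat \<Rightarrow> 'k) \<Rightarrow> nat \<Rightarrow> nat \<Rightarrow> 'k poly \<Rightarrow> 'k" where
  "row_functional s d U i j h =
     (\<Sum>l\<in>insert j {..<i}. U l j * poly (nodal (s ` {j<..d}) * h) (s l))"

text \<open>Kernel elements of the Hankel form of row \<open>j\<close> only have to vanish at the
  points \<open>s l\<close> with \<open>l < i\<close>. This is void for \<open>i = 0\<close>, can be
  extended by one point per step, and for \<open>j = i > 0\<close> means a trivial kernel, as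
  \<open>i div 2 < i\<close>.\<close>

definition nondegenerate_rows ::
  "(nat \<Rightarrow> 'k::field) \<Rightarrow> nat \<Rightarrow> (nat \<Rightarrow> nat \<Rightarrow> 'k) \<Rightarrow> nat \<Rightarrow> bool" where
  "nondegenerate_rows s d U i \<longleftrightarrow> (\<forall>j\<in>{i..d}. \<forall>r. degree r \<le> j div 2 \<longrightarrow>
     (\<forall>p. degree p \<le> j div 2 \<longrightarrow> row_functional s d U i j (r * p) = 0) \<longrightarrow>
     (\<forall>l<i. poly r (s l) = 0))"

definition rest_sum ::
  "(nat \<Rightarrow> 'k::field) \<Rightarrow> nat \<Rightarrow> (nat \<Rightarrow> nat \<Rightarrow> 'k) \<Rightarrow> nat \<Rightarrow> ('k \<Rightarrow> 'k \<Rightarrow> 'k) \<Rightarrow> 'k" where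
  "rest_sum s d U i E = (\<Sum>j=i..d. \<Sum>l\<le>j. U l j * E (s l) (s j))"

text \<open>If kernel elements \<open>r\<close> and \<open>r'\<close> for different \<open>c\<close>
  and \<open>c'\<close> were both nonzero at \<open>x\<close>, pairing them with each other in both
  forms would give \<open>c' * poly (r * r') x = c * poly (r * r') x\<close>. So at most one
  \<open>c\<close> is bad.\<close>

lemma ex_kernel_vanishes:
  fixes \<phi> :: "'k::field poly \<Rightarrow> 'k"
  shows "\<exists>\<gamma>. \<forall>c. c \<noteq> \<gamma> \<longrightarrow> (\<forall>r. degree r \<le> k \<longrightarrow>
    (\<forall>p. degree p \<le> k \<longrightarrow> \<phi> (r * p) + c * poly (r * p) x = 0) \<longrightarrow> poly r x = 0)"
proof (rule ccontr)
  assume neg: "\<not> ?thesis"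
  define bad where "bad c r \<longleftrightarrow> degree r \<le> k \<and> poly r x \<noteq> 0 \<and>
    (\<forall>p. degree p \<le> k \<longrightarrow> \<phi> (r * p) + c * poly (r * p) x = 0)" for c r
  obtain c r where cr: "bad c r" using neg unfolding bad_def by blast
  obtain c' r' where cr': "bad c' r'" "c' \<noteq> c" using neg unfolding bad_def by blast
  have "\<phi> (r * r') + c * poly (r * r') x = 0" "\<phi> (r' * r) + c' * poly (r' * r) x = 0"
    using cr cr' unfolding bad_def by blast+
  then have "c' * poly (r * r') x = c * poly (r * r') x"
    by (metis add_left_cancel mult.commute)
  then show False using cr cr' by (simp add: bad_def)
qed

lemma sum_list_set_distinct:
  assumes "finite T"
  shows "\<exists>xs. length xs = card T \<and> (\<forall>g::_ \<Rightarrow> 'b::comm_monoid_add. sum_list (map g xs) = sum g T)"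
proof -
  obtain xs where xs: "set xs = T" "distinct xs" using finite_distinct_list[OF assms] by blast
  then show ?thesis
    by (intro exI[of _ xs]) (auto simp: sum_list_distinct_conv_sum_set distinct_card)
qed

text \<open>This is \<open>line_decomposition\<close> with \<open>n = i\<close>: \<open>S\<close>
  holds the \<open>d - i\<close> points on the later lines, whose weights may change, and the
  condition on row \<open>i\<close> supplies the nondegeneracy.\<close>

lemma row_decomposition:
  fixes s :: "nat \<Rightarrow> 'k::{alg_closed_field,field_char_0}"
  assumes s: "inj s" and "i \<le> d" and U: "nondegenerate_rows s d U i"
  shows "\<exists>L c. length L \<le> (if i = 0 then d + 1 else i + 1 - i div 2) \<and> (\<forall>j\<in>{i<..d}. c j \<noteq> \<beta> j) \<and>
    (\<forall>h. degree h \<le> d \<longrightarrow> (\<Sum>l\<le>i. U l i * poly h (s l)) =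
      (\<Sum>(a, y)\<leftarrow>L. a * poly h y) + (\<Sum>j\<in>{i<..d}. c j * poly h (s j)))"
proof (cases "i = 0")
  case True
  \<comment> \<open>On line \<open>0\<close> nondegeneracy would mean
    \<open>U 0 0 \<noteq> 0\<close>, which may fail. Instead any weights other than
    \<open>\<beta> j\<close> are chosen and cancelled by new points at the same places, at a single
    cost of \<open>d + 1\<close> points.\<close>
  define c where "c j = \<beta> j + 1" for j
  define L where "L = (U 0 0, s 0) # map (\<lambda>j. (- c j, s j)) [1..<Suc d]"
  have L: "(\<Sum>(a, y)\<leftarrow>L. a * poly h y) = U 0 0 * poly h (s 0) - (\<Sum>j\<in>{0<..d}. c j * poly h (s j))" for h
  proof -
    have "{1..<Suc d} = {0<..d}" by auto
    then show ?thesis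
      by (simp add: L_def o_def sum_negf sum_list_distinct_conv_sum_set del: upt_Suc)
  qed
  show ?thesis
  proof (intro exI[of _ L] exI[of _ c] conjI ballI allI impI)
    show "length L \<le> (if i = 0 then d + 1 else i + 1 - i div 2)"
      using True by (simp add: L_def)
    show "c j \<noteq> \<beta> j" for j by (simp add: c_def)
  qed (use True in \<open>simp add: L\<close>)
next
  case False
  define \<phi> where "\<phi> h = (\<Sum>l\<le>i. U l i * poly h (s l))" for h
  define S where "S = s ` {i<..d}"
  have inj: "inj_on s A" for A using s by (rule inj_on_subset) simp
  have card: "i + card S = d" using \<open>i \<le> d\<close> by (simp add: S_def card_image inj)
  have \<phi>: "functional \<phi>"
    by (rule functionalI) (simp_all add: \<phi>_def algebra_simps sum.distrib sum_distrib_left)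
  have row: "row_functional s d U i i h = \<phi> (nodal S * h)" for h
  proof -
    have "insert i {..<i} = {..i}" by auto
    then show ?thesis by (simp add: row_functional_def \<phi>_def S_def)
  qed
  have nondeg: "r = 0" if r: "degree r \<le> i div 2" "\<And>p. degree p \<le> i div 2 \<Longrightarrow> \<phi> (nodal S * (r * p)) = 0" for r
  proof (rule poly_eqI_degree)
    show "poly r x = poly 0 x" if "x \<in> s ` {..<i}" for x
      using U[unfolded nondegenerate_rows_def, rule_format, of i r] r \<open>i \<le> d\<close> that
      by (auto simp: row)
    show "degree r < card (s ` {..<i})" "degree 0 < card (s ` {..<i})"
      using r(1) False by (auto simp: card_image inj)
  qed
  have "finite S" by (simp add: S_def)
  then have "\<exists>T \<alpha> c. finite T \<and> card T = i + 1 - i div 2 \<and>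
    (\<forall>q\<in>S. c q \<noteq> \<beta> (inv s q)) \<and> (\<forall>h. degree h \<le> i + card S \<longrightarrow>
      \<phi> h = (\<Sum>p\<in>T. \<alpha> p * poly h p) + (\<Sum>q\<in>S. c q * poly h q))"
    using nondeg by (rule line_decomposition[OF \<phi>])
  then obtain T \<alpha> c where "finite T \<and> card T = i + 1 - i div 2 \<and>
    (\<forall>q\<in>S. c q \<noteq> \<beta> (inv s q)) \<and> (\<forall>h. degree h \<le> i + card S \<longrightarrow>
      \<phi> h = (\<Sum>p\<in>T. \<alpha> p * poly h p) + (\<Sum>q\<in>S. c q * poly h q))"
    by (elim exE)
  then have T: "finite T" "card T = i + 1 - i div 2" "\<And>q. q \<in> S \<Longrightarrow> c q \<noteq> \<beta> (inv s q)"
    "\<And>h. degree h \<le> i + card S \<Longrightarrow> \<phi> h = (\<Sum>p\<in>T. \<alpha> p * poly h p) + (\<Sum>q\<in>S. c q * poly h q)"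
    by simp_all
  obtain xs where xs: "length xs = card T" "\<And>g::_ \<Rightarrow> 'k. sum_list (map g xs) = sum g T"
    using sum_list_set_distinct[OF T(1)] by blast
  have "(\<Sum>l\<le>i. U l i * poly h (s l)) = (\<Sum>(a, y)\<leftarrow>map (\<lambda>y. (\<alpha> y, y)) xs. a * poly h y) +
      (\<Sum>j\<in>{i<..d}. c (s j) * poly h (s j))" if "degree h \<le> d" for h
    using T(4)[of h] that card
    by (simp add: \<phi>_def o_def xs(2) S_def sum.reindex[OF inj])
  moreover have "c (s j) \<noteq> \<beta> j" if "j \<in> {i<..d}" for j
    using T(3)[of "s j"] that s by (simp add: S_def)
  ultimately show ?thesis
    using False xs(1) T(2)
    by (intro exI[of _ "map (\<lambda>y. (\<alpha> y, y)) xs"] exI[of _ "\<lambda>j. c (s j)"]) auto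
qed

text \<open>Making \<open>U i j + c j\<close> final adds an evaluation at \<open>s i\<close> to the
  form of each row \<open>j > i\<close>. Outside one bad value, the new kernel vanishes at
  \<open>s i\<close>; the added term then drops out, so this kernel lies in the old one and vanishes
  at the earlier points too.\<close>

lemma sweep_step:
  fixes s :: "nat \<Rightarrow> 'k::{alg_closed_field,field_char_0}"
  assumes s: "inj s" and "i \<le> d" and U: "nondegenerate_rows s d U i"
  shows "\<exists>L U'. length L \<le> (if i = 0 then d + 1 else i + 1 - i div 2) \<and>
    nondegenerate_rows s d U' (Suc i) \<and>
    (\<forall>E. sym_bidegree d E \<longrightarrow>
      rest_sum s d U i E = (\<Sum>(a, x, y)\<leftarrow>L. a * E x y) + rest_sum s d U' (Suc i) E)"
proof -
  define Q where "Q j = poly (nodal (s ` {j<..d})) (s i)" for j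
  have Q: "Q j \<noteq> 0" if "i < j" for j
    using that s by (auto simp: Q_def poly_nodal_eq_0_iff dest: injD)
  have "\<forall>j. \<exists>\<gamma>. \<forall>c. c \<noteq> \<gamma> \<longrightarrow> (\<forall>r. degree r \<le> j div 2 \<longrightarrow>
      (\<forall>p. degree p \<le> j div 2 \<longrightarrow>
        row_functional s d U i j (r * p) + c * poly (r * p) (s i) = 0) \<longrightarrow> poly r (s i) = 0)"
    using ex_kernel_vanishes by blast
  from choice[OF this] obtain \<gamma> where "\<forall>j c. c \<noteq> \<gamma> j \<longrightarrow> (\<forall>r. degree r \<le> j div 2 \<longrightarrow>
      (\<forall>p. degree p \<le> j div 2 \<longrightarrow>
        row_functional s d U i j (r * p) + c * poly (r * p) (s i) = 0) \<longrightarrow> poly r (s i) = 0)"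
    by (elim exE)
  note \<gamma> = this[rule_format]
  \<comment> \<open>The new weight enters row \<open>j\<close> multiplied by \<open>Q j\<close>;
    excluding this value of \<open>c j\<close> keeps \<open>(U i j + c j) * Q j\<close> away from
    the bad \<open>\<gamma> j\<close>.\<close>
  from row_decomposition[OF assms, of "\<lambda>j. \<gamma> j / Q j - U i j"] obtain L c
    where "length L \<le> (if i = 0 then d + 1 else i + 1 - i div 2) \<and>
      (\<forall>j\<in>{i<..d}. c j \<noteq> \<gamma> j / Q j - U i j) \<and>
      (\<forall>h. degree h \<le> d \<longrightarrow> (\<Sum>l\<le>i. U l i * poly h (s l)) =
        (\<Sum>(a, y)\<leftarrow>L. a * poly h y) + (\<Sum>j\<in>{i<..d}. c j * poly h (s j)))"
    by (elim exE)
  note L = this[THEN conjunct1] and c = this[THEN conjunct2, THEN conjunct1, rule_format]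
    and eq = this[THEN conjunct2, THEN conjunct2, rule_format]
  define U' where "U' l j = (if l = i then U l j + c j else U l j)" for l j
  have "nondegenerate_rows s d U' (Suc i)"
    unfolding nondegenerate_rows_def
  proof (intro ballI allI impI)
    fix j r l
    assume j: "j \<in> {Suc i..d}" and r: "degree r \<le> j div 2" and "l < Suc i"
      and ker: "\<forall>p. degree p \<le> j div 2 \<longrightarrow> row_functional s d U' (Suc i) j (r * p) = 0"
    have row: "row_functional s d U' (Suc i) j h =
        row_functional s d U i j h + (U i j + c j) * Q j * poly h (s i)" for h
    proof -
      let ?g = "poly (nodal (s ` {j<..d}) * h)"
      have ins: "insert j {..<Suc i} = insert i (insert j {..<i})" by auto
      have "row_functional s d U' (Suc i) j h =
          (\<Sum>l\<in>insert j {..<i}. U' l j * ?g (s l)) + U' i j * ?g (s i)"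
        unfolding row_functional_def ins using j by (subst sum.insert) auto
      also have "(\<Sum>l\<in>insert j {..<i}. U' l j * ?g (s l)) = row_functional s d U i j h"
        unfolding row_functional_def using j by (intro sum.cong) (auto simp: U'_def)
      also have "U' i j = U i j + c j" by (simp add: U'_def)
      finally show ?thesis by (simp add: Q_def mult.assoc)
    qed
    have "(U i j + c j) * Q j \<noteq> \<gamma> j"
    proof
      assume "(U i j + c j) * Q j = \<gamma> j"
      then have "U i j + c j = \<gamma> j / Q j" using Q[of j] j by (simp add: eq_divide_eq)
      then show False using c[of j] j by (simp add: algebra_simps)
    qed
    then have ri: "poly r (s i) = 0"
    proof (rule \<gamma>[OF _ r])
      show "row_functional s d U i j (r * p) + (U i j + c j) * Q j * poly (r * p) (s i) = 0"
        if "degree p \<le> j div 2" for p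
        using ker that row[of "r * p"] by simp
    qed
    then have "row_functional s d U i j (r * p) = 0" if "degree p \<le> j div 2" for p
      using ker row that by simp
    then have "\<forall>l<i. poly r (s l) = 0"
      using U[unfolded nondegenerate_rows_def, rule_format, of j r] j r by auto
    then show "poly r (s l) = 0" using ri \<open>l < Suc i\<close> by (auto simp: less_Suc_eq)
  qed
  moreover have "rest_sum s d U i E =
      (\<Sum>(a, x, y)\<leftarrow>map (\<lambda>(a, y). (a, s i, y)) L. a * E x y) + rest_sum s d U' (Suc i) E"
    if E: "sym_bidegree d E" for E
  proof -
    \<comment> \<open>On line \<open>i\<close> the function is a polynomial \<open>h\<close>; by
      symmetry the points \<open>(s l, s i)\<close> are read on this line as well.\<close>
    obtain h where h: "degree h \<le> d" "\<And>y. E (s i) y = poly h y" and sym: "\<And>x y. E x y = E y x"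
      using E unfolding sym_bidegree_def by blast
    have "(\<Sum>l\<le>j. U' l j * E (s l) (s j)) =
        (\<Sum>l\<le>j. U l j * E (s l) (s j)) + c j * E (s i) (s j)" if "j \<in> {Suc i..d}" for j
    proof -
      have "(\<Sum>l\<le>j. U' l j * E (s l) (s j)) =
          (\<Sum>l\<le>j. U l j * E (s l) (s j) + (if l = i then c j * E (s i) (s j) else 0))"
        by (intro sum.cong) (auto simp: U'_def algebra_simps)
      then show ?thesis using that by (simp add: sum.distrib)
    qed
    then have "rest_sum s d U' (Suc i) E =
        rest_sum s d U (Suc i) E + (\<Sum>j\<in>{i<..d}. c j * E (s i) (s j))"
      by (simp add: rest_sum_def sum.distrib atLeastSucAtMost_greaterThanAtMost)
    moreover have "rest_sum s d U i E =
        (\<Sum>l\<le>i. U l i * poly h (s l)) + rest_sum s d U (Suc i) E"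
      using \<open>i \<le> d\<close> by (simp add: rest_sum_def sum.atLeast_Suc_atMost sym[of _ "s i"] h(2))
    moreover have "(\<Sum>(a, x, y)\<leftarrow>map (\<lambda>(a, y). (a, s i, y)) L. a * E x y) = (\<Sum>(a, y)\<leftarrow>L. a * poly h y)"
      by (simp add: o_def case_prod_unfold h(2))
    ultimately show ?thesis using eq[OF h(1)] by (simp add: h(2))
  qed
  moreover have "length (map (\<lambda>(a, y). (a, s i, y)) L) \<le> (if i = 0 then d + 1 else i + 1 - i div 2)"
    using L by (simp only: length_map)
  ultimately show ?thesis
    by (intro exI[of _ "map (\<lambda>(a, y). (a, s i, y)) L"] exI[of _ U'] conjI allI impI)
qed

lemma sweep:
  fixes s :: "nat \<Rightarrow> 'k::{alg_closed_field,field_char_0}"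
  assumes s: "inj s" and "i \<le> d"
  shows "\<exists>L U'. 4 * length L \<le> 4 * d + 4 + i\<^sup>2 + 7 * i \<and> nondegenerate_rows s d U' (Suc i) \<and>
    (\<forall>E. sym_bidegree d E \<longrightarrow>
      rest_sum s d U 0 E = (\<Sum>(a, x, y)\<leftarrow>L. a * E x y) + rest_sum s d U' (Suc i) E)"
  using assms(2)
proof (induction i)
  case 0
  have "nondegenerate_rows s d U 0" by (simp add: nondegenerate_rows_def)
  from sweep_step[OF s le0 this] obtain L U'
    where "length L \<le> (if (0::nat) = 0 then d + 1 else 0 + 1 - 0 div 2) \<and>
      nondegenerate_rows s d U' (Suc 0) \<and> (\<forall>E. sym_bidegree d E \<longrightarrow>
        rest_sum s d U 0 E = (\<Sum>(a, x, y)\<leftarrow>L. a * E x y) + rest_sum s d U' (Suc 0) E)"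
    by (elim exE)
  note L = this[THEN conjunct1] this[THEN conjunct2]
  have "4 * length L \<le> 4 * d + 4 + 0\<^sup>2 + 7 * 0" using L(1) by simp
  then show ?case by (intro exI[of _ L] exI[of _ U'] conjI L(2))
next
  case (Suc i)
  have "i \<le> d" using Suc.prems by simp
  from Suc.IH[OF this] obtain L U' where "4 * length L \<le> 4 * d + 4 + i\<^sup>2 + 7 * i \<and>
    nondegenerate_rows s d U' (Suc i) \<and> (\<forall>E. sym_bidegree d E \<longrightarrow>
      rest_sum s d U 0 E = (\<Sum>(a, x, y)\<leftarrow>L. a * E x y) + rest_sum s d U' (Suc i) E)"
    by (elim exE)
  note L = this[THEN conjunct1] this[THEN conjunct2, THEN conjunct1]
    this[THEN conjunct2, THEN conjunct2, rule_format]
  from sweep_step[OF s Suc.prems L(2)] obtain L' U''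
    where "length L' \<le> (if Suc i = 0 then d + 1 else Suc i + 1 - Suc i div 2) \<and>
      nondegenerate_rows s d U'' (Suc (Suc i)) \<and> (\<forall>E. sym_bidegree d E \<longrightarrow>
        rest_sum s d U' (Suc i) E =
          (\<Sum>(a, x, y)\<leftarrow>L'. a * E x y) + rest_sum s d U'' (Suc (Suc i)) E)"
    by (elim exE)
  note L' = this[THEN conjunct1] this[THEN conjunct2, THEN conjunct1]
    this[THEN conjunct2, THEN conjunct2, rule_format]
  have "length L' \<le> Suc i + 1 - Suc i div 2" using L'(1) by (simp only: nat.distinct if_False)
  \<comment> \<open>\<open>2 * i + 8\<close> is exactly the increment of
    \<open>i\<^sup>2 + 7 * i\<close> from \<open>i\<close> to \<open>Suc i\<close>.\<close>
  then have "4 * length L' \<le> 2 * i + 8" by linarith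
  then have "4 * length (L @ L') \<le> 4 * d + 4 + (Suc i)\<^sup>2 + 7 * Suc i"
    using L(1) by (simp add: power2_eq_square)
  moreover have "rest_sum s d U 0 E =
      (\<Sum>(a, x, y)\<leftarrow>L @ L'. a * E x y) + rest_sum s d U'' (Suc (Suc i)) E"
    if "sym_bidegree d E" for E
    by (simp only: L(3)[OF that] L'(3)[OF that] map_append sum_list_append add.assoc)
  ultimately show ?case
    by (intro exI[of _ "L @ L'"] exI[of _ U''] conjI allI impI L'(2))
qed

section \<open>Functionals given by moments as weights at the points where the lines meet\<close>

text \<open>
  A functional on symmetric polynomials is extended to all polynomials in \<open>x\<close> and \<open>y\<close> by
  sending \<open>x\<^sup>p y\<^sup>q\<close> to \<open>0\<close> for \<open>p > q\<close>; \<open>half_moment \<Phi> a b\<close> is then its value at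
  \<open>x\<^sup>b y\<^bsup>a + b\<^esup>\<close>, determined by the expansion of \<open>(x + y)\<^sup>a (x y)\<^sup>b\<close>.
\<close>

function half_moment :: "(nat \<Rightarrow> nat \<Rightarrow> 'k::comm_ring_1) \<Rightarrow> nat \<Rightarrow> nat \<Rightarrow> 'k" where
  "half_moment \<Phi> a b =
     \<Phi> a b - (\<Sum>k\<in>{1..a div 2}. of_nat (a choose k) * half_moment \<Phi> (a - 2 * k) (b + k))"
  by auto
termination by (relation "measure (\<lambda>(\<Phi>, a, b). a)") auto

declare half_moment.simps [simp del]

lemma ex_bimoments:
  fixes \<Phi> :: "nat \<Rightarrow> nat \<Rightarrow> 'k::comm_ring_1"
  shows "\<exists>\<Psi>. \<forall>a b. \<Phi> a b = (\<Sum>k\<le>a. of_nat (a choose k) * \<Psi> (b + k) (b + (a - k)))"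
proof -
  define \<Psi> where "\<Psi> p q = (if p \<le> q then half_moment \<Phi> (q - p) p else 0)" for p q
  have "\<Phi> a b = (\<Sum>k\<le>a. of_nat (a choose k) * \<Psi> (b + k) (b + (a - k)))" for a b
  proof -
    let ?f = "\<lambda>k. of_nat (a choose k) * half_moment \<Phi> (a - 2 * k) (b + k)"
    \<comment> \<open>For \<open>k > a div 2\<close> the first exponent is the larger one, where
      \<open>\<Psi>\<close> is \<open>0\<close>; the recursion is solved for the term
      \<open>k = 0\<close>.\<close>
    have "(\<Sum>k\<le>a. of_nat (a choose k) * \<Psi> (b + k) (b + (a - k))) = (\<Sum>k\<le>a div 2. ?f k)"
    proof (rule sum.mono_neutral_cong_right)
      show "of_nat (a choose k) * \<Psi> (b + k) (b + (a - k)) = ?f k" if "k \<in> {..a div 2}" for k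
      proof -
        have "k \<le> a - k" "a - k - k = a - 2 * k" using that by auto
        then show ?thesis by (simp add: \<Psi>_def)
      qed
    qed (auto simp: \<Psi>_def)
    also have "\<dots> = ?f 0 + (\<Sum>k\<in>{1..a div 2}. ?f k)"
      by (simp add: atMost_atLeast0 sum.atLeast_Suc_atMost)
    also have "\<dots> = \<Phi> a b" by (simp add: half_moment.simps[of \<Phi> a b])
    finally show ?thesis by simp
  qed
  then show ?thesis by blast
qed

text \<open>Lagrange interpolation in both variables: \<open>W i j\<close> is the value of the
  functional with moments \<open>\<Psi>\<close> at the product of the basis polynomials
  \<open>l i\<close> and \<open>l j\<close>.\<close>

lemma ex_quadrature_moments:
  fixes s :: "nat \<Rightarrow> 'k::field"
  assumes "inj s"
  shows "\<exists>W. \<forall>P Q. P \<le> d \<longrightarrow> Q \<le> d \<longrightarrow> \<Psi> P Q = (\<Sum>i\<le>d. \<Sum>j\<le>d. W i j * (s i ^ P * s j ^ Q))"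
proof -
  define l where "l i = lagrange (s ` {..d}) (s i)" for i
  define W where "W i j = (\<Sum>p\<le>d. \<Sum>q\<le>d. \<Psi> p q * (coeff (l i) p * coeff (l j) q))" for i j
  have inj: "inj_on s A" for A using assms by (rule inj_on_subset) simp
  \<comment> \<open>The coefficients of the \<open>l i\<close> invert the Vandermonde matrix:
    compare coefficients in the interpolation of \<open>monom 1 P\<close>.\<close>
  have delta: "(\<Sum>i\<le>d. s i ^ P * coeff (l i) p) = (if p = P then 1 else 0)" if "P \<le> d" for P p
  proof -
    have "monom 1 P = (\<Sum>z\<in>s ` {..d}. smult (poly (monom 1 P) z) (lagrange (s ` {..d}) z))"
      using that by (intro lagrange_interpolation) (auto simp: card_image inj degree_monom_eq)
    also have "\<dots> = (\<Sum>i\<le>d. smult (s i ^ P) (l i))"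
      by (simp add: sum.reindex[OF inj] l_def poly_monom)
    finally have "coeff (monom 1 P) p = coeff (\<Sum>i\<le>d. smult (s i ^ P) (l i)) p" by simp
    then show ?thesis by (simp add: coeff_sum eq_commute)
  qed
  have "(\<Sum>i\<le>d. \<Sum>j\<le>d. W i j * (s i ^ P * s j ^ Q)) = \<Psi> P Q" if "P \<le> d" "Q \<le> d" for P Q
  proof -
    have "(\<Sum>i\<le>d. \<Sum>j\<le>d. W i j * (s i ^ P * s j ^ Q)) =
      (\<Sum>i\<le>d. \<Sum>j\<le>d. \<Sum>p\<le>d. \<Sum>q\<le>d. \<Psi> p q * ((s i ^ P * coeff (l i) p) * (s j ^ Q * coeff (l j) q)))"
      by (simp add: W_def sum_distrib_left sum_distrib_right mult_ac)
    also have "\<dots> = (\<Sum>i\<le>d. \<Sum>p\<le>d. \<Sum>j\<le>d. \<Sum>q\<le>d. \<Psi> p q * ((s i ^ P * coeff (l i) p) * (s j ^ Q * coeff (l j) q)))"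
      by (intro sum.cong refl sum.swap)
    also have "\<dots> = (\<Sum>p\<le>d. \<Sum>i\<le>d. \<Sum>j\<le>d. \<Sum>q\<le>d. \<Psi> p q * ((s i ^ P * coeff (l i) p) * (s j ^ Q * coeff (l j) q)))"
      by (rule sum.swap)
    also have "\<dots> = (\<Sum>p\<le>d. \<Sum>i\<le>d. \<Sum>q\<le>d. \<Sum>j\<le>d. \<Psi> p q * ((s i ^ P * coeff (l i) p) * (s j ^ Q * coeff (l j) q)))"
      by (intro sum.cong refl sum.swap)
    also have "\<dots> = (\<Sum>p\<le>d. \<Sum>q\<le>d. \<Sum>i\<le>d. \<Sum>j\<le>d. \<Psi> p q * ((s i ^ P * coeff (l i) p) * (s j ^ Q * coeff (l j) q)))"
      by (intro sum.cong refl sum.swap)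
    also have "\<dots> = (\<Sum>p\<le>d. \<Sum>q\<le>d. \<Psi> p q * ((\<Sum>i\<le>d. s i ^ P * coeff (l i) p) * (\<Sum>j\<le>d. s j ^ Q * coeff (l j) q)))"
      by (intro sum.cong refl, subst sum_product) (simp add: sum_distrib_left)
    also have "\<dots> = (\<Sum>p\<le>d. \<Sum>q\<le>d. if p = P then if q = Q then \<Psi> p q else 0 else 0)"
      using that by (intro sum.cong) (auto simp: delta)
    also have "\<dots> = (\<Sum>p\<le>d. if p = P then \<Psi> p Q else 0)"
      using that by (intro sum.cong) auto
    finally show ?thesis using that by simp
  qed
  then show ?thesis by (intro exI[of _ W] allI impI, rule sym, blast)
qed

lemma sum_square_fold:
  fixes f :: "nat \<Rightarrow> nat \<Rightarrow> 'a::comm_monoid_add"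
  shows "(\<Sum>i\<le>d. \<Sum>j\<le>d. f i j) = (\<Sum>j\<le>d. \<Sum>l\<le>j. if l = j then f j j else f l j + f j l)"
proof (induction d)
  case (Suc d)
  have "(\<Sum>i\<le>Suc d. \<Sum>j\<le>Suc d. f i j) =
      (\<Sum>i\<le>d. \<Sum>j\<le>d. f i j) + ((\<Sum>l\<le>d. f l (Suc d) + f (Suc d) l) + f (Suc d) (Suc d))"
    by (simp add: sum.distrib ac_simps)
  moreover have "(\<Sum>l\<le>d. if l = Suc d then f (Suc d) (Suc d) else f l (Suc d) + f (Suc d) l) =
      (\<Sum>l\<le>d. f l (Suc d) + f (Suc d) l)"
    by (intro sum.cong) auto
  ultimately show ?case using Suc.IH by simp
qed simp

lemma ex_power_moments:
  fixes \<Phi> :: "nat \<Rightarrow> nat \<Rightarrow> 'k::{alg_closed_field,field_char_0}"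
  shows "\<exists>L. 4 * length L \<le> d\<^sup>2 + 11 * d + 4 \<and>
    (\<forall>a b. a + b \<le> d \<longrightarrow> \<Phi> a b = (\<Sum>(\<alpha>, u, v)\<leftarrow>L. \<alpha> * (u ^ a * v ^ b)))"
proof -
  define s :: "nat \<Rightarrow> 'k" where "s = of_nat"
  have s: "inj s" by (simp add: s_def inj_of_nat)
  define E where "E a b x y = (x + y) ^ a * (x * y) ^ b" for a b and x y :: 'k
  have E_sym: "E a b x y = E a b y x" for a b x y
    by (simp add: E_def add.commute mult.commute)
  have E_eq: "E a b x y = (\<Sum>k\<le>a. of_nat (a choose k) * (x ^ (b + k) * y ^ (b + (a - k))))" for a b x y
    by (simp only: E_def binomial_ring sum_distrib_right power_add power_mult_distrib)
      (simp only: mult_ac)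
  have E: "sym_bidegree d (E a b)" if "a + b \<le> d" for a b
    unfolding sym_bidegree_def
  proof (intro conjI allI)
    show "\<exists>h. degree h \<le> d \<and> (\<forall>y. E a b x y = poly h y)" for x
    proof (intro exI conjI allI)
      have "degree ([:x, 1:] ^ a * [:0, x:] ^ b) \<le> degree [:x, 1:] * a + degree [:0, x:] * b"
        by (intro order_trans[OF degree_mult_le] add_mono degree_power_le)
      also have "\<dots> \<le> d" using that by auto
      finally show "degree ([:x, 1:] ^ a * [:0, x:] ^ b) \<le> d" .
    qed (simp add: E_def poly_power mult.commute)
  qed (simp add: E_def add.commute mult.commute)
  \<comment> \<open>In turn: moments in \<open>x\<close> and \<open>y\<close>, weights on the full
    grid and, as \<open>E a b\<close> is symmetric, weights on the half
    \<open>l \<le> j\<close>.\<close>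
  obtain \<Psi> where \<Psi>: "\<And>a b. \<Phi> a b = (\<Sum>k\<le>a. of_nat (a choose k) * \<Psi> (b + k) (b + (a - k)))"
    using ex_bimoments by blast
  obtain W where W: "\<And>P Q. P \<le> d \<Longrightarrow> Q \<le> d \<Longrightarrow>
      \<Psi> P Q = (\<Sum>i\<le>d. \<Sum>j\<le>d. W i j * (s i ^ P * s j ^ Q))"
    using ex_quadrature_moments[OF s, of d \<Psi>] by blast
  define U where "U l j = (if l = j then W j j else W l j + W j l)" for l j
  have \<Phi>: "\<Phi> a b = rest_sum s d U 0 (E a b)" if "a + b \<le> d" for a b
  proof -
    have "\<Phi> a b = (\<Sum>k\<le>a. \<Sum>i\<le>d. \<Sum>j\<le>d.
        W i j * (of_nat (a choose k) * (s i ^ (b + k) * s j ^ (b + (a - k)))))"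
      using that by (simp add: \<Psi> W sum_distrib_left mult_ac)
    also have "\<dots> = (\<Sum>i\<le>d. \<Sum>k\<le>a. \<Sum>j\<le>d.
        W i j * (of_nat (a choose k) * (s i ^ (b + k) * s j ^ (b + (a - k)))))"
      by (rule sum.swap)
    also have "\<dots> = (\<Sum>i\<le>d. \<Sum>j\<le>d. \<Sum>k\<le>a.
        W i j * (of_nat (a choose k) * (s i ^ (b + k) * s j ^ (b + (a - k)))))"
      by (intro sum.cong refl sum.swap)
    also have "\<dots> = (\<Sum>i\<le>d. \<Sum>j\<le>d. W i j * E a b (s i) (s j))"
      by (simp only: E_eq sum_distrib_left)
    also have "\<dots> = rest_sum s d U 0 (E a b)"
      unfolding rest_sum_def atLeast0AtMost
      by (subst sum_square_fold, intro sum.cong refl) (simp add: U_def distrib_right E_sym)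
    finally show ?thesis .
  qed
  obtain L U' where L: "4 * length L \<le> 4 * d + 4 + d\<^sup>2 + 7 * d"
    "\<And>E. sym_bidegree d E \<Longrightarrow>
      rest_sum s d U 0 E = (\<Sum>(a, x, y)\<leftarrow>L. a * E x y) + rest_sum s d U' (Suc d) E"
    using sweep[OF s order_refl[of d]] by blast
  \<comment> \<open>From \<open>Suc d\<close> on \<open>rest_sum\<close> is empty, so nothing
    remains; each node is taken back to the coordinates \<open>(x + y, x * y)\<close>.\<close>
  let ?L = "map (\<lambda>(a, x, y). (a, x + y, x * y)) L"
  have eq: "\<Phi> a b = (\<Sum>(\<alpha>, u, v)\<leftarrow>?L. \<alpha> * (u ^ a * v ^ b))" if "a + b \<le> d" for a b
    using L(2)[OF E[OF that]]
    by (simp add: \<Phi>[OF that] rest_sum_def o_def case_prod_unfold E_def)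
  show ?thesis
  proof (intro exI[of _ ?L] conjI allI impI)
    show "4 * length ?L \<le> d\<^sup>2 + 11 * d + 4" using L(1) by simp
  qed (rule eq)
qed

subsection \<open>Ternary forms\<close>

definition mono3 :: "nat \<Rightarrow> nat \<Rightarrow> nat \<Rightarrow> (nat \<Rightarrow>\<^sub>0 nat)" where
  "mono3 a b c = Poly_Mapping.single 0 a + Poly_Mapping.single 1 b + Poly_Mapping.single 2 c"

definition linear_form :: "'k \<Rightarrow> 'k \<Rightarrow> 'k \<Rightarrow> 'k::comm_ring_1 mpoly" where
  "linear_form p q w = Poly_Mapping.single (Poly_Mapping.single 0 1) p +
     (Poly_Mapping.single (Poly_Mapping.single 1 1) q + Poly_Mapping.single (Poly_Mapping.single 2 1) w)"

lemma lookup_mono3: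
  "Poly_Mapping.lookup (mono3 a b c) i = (if i = 0 then a else if i = 1 then b else if i = 2 then c else 0)"
  by (simp add: mono3_def lookup_add lookup_single when_def)

lemma mono3_eq_iff: "mono3 a b c = mono3 a' b' c' \<longleftrightarrow> a = a' \<and> b = b' \<and> c = c'"
proof
  assume "mono3 a b c = mono3 a' b' c'"
  then have "Poly_Mapping.lookup (mono3 a b c) i = Poly_Mapping.lookup (mono3 a' b' c') i" for i
    by simp
  from this[of 0] this[of 1] this[of 2] show "a = a' \<and> b = b' \<and> c = c'"
    by (simp_all add: lookup_mono3)
qed simp

lemma keys_mono3: "Poly_Mapping.keys (mono3 a b c) \<subseteq> {..<3}"
  by (auto simp: in_keys_iff lookup_mono3 split: if_splits)

lemma sum_lookup_mono3: "(\<Sum>i<3. Poly_Mapping.lookup (mono3 a b c) i) = a + b + c"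
  by (simp add: lookup_mono3 eval_nat_numeral)

lemma eq_mono3I:
  assumes "Poly_Mapping.keys m \<subseteq> {..<3}" "(\<Sum>i<3. Poly_Mapping.lookup m i) = d"
  shows "\<exists>a b. a + b \<le> d \<and> m = mono3 a b (d - a - b)"
proof (intro exI conjI)
  let ?a = "Poly_Mapping.lookup m 0" and ?b = "Poly_Mapping.lookup m 1"
  have d: "?a + ?b + Poly_Mapping.lookup m 2 = d"
    using assms(2) by (simp add: eval_nat_numeral)
  then show "?a + ?b \<le> d" by linarith
  show "m = mono3 ?a ?b (d - ?a - ?b)"
  proof (rule poly_mapping_eqI)
    fix i :: nat
    consider "i = 0" | "i = 1" | "i = 2" | "i \<notin> {..<3}"
      unfolding lessThan_iff by linarith
    then show "Poly_Mapping.lookup m i = Poly_Mapping.lookup (mono3 ?a ?b (d - ?a - ?b)) i"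
    proof cases
      case 4
      then have "Poly_Mapping.lookup m i = 0" using assms(1) by (auto simp: in_keys_iff)
      then show ?thesis using 4 by (simp add: lookup_mono3)
    qed (use d in \<open>auto simp: lookup_mono3\<close>)
  qed
qed

lemma forms3_eqI:
  assumes "f \<in> forms 3 d" "g \<in> forms 3 d"
    and "\<And>a b. a + b \<le> d \<Longrightarrow>
      Poly_Mapping.lookup f (mono3 a b (d - a - b)) = Poly_Mapping.lookup g (mono3 a b (d - a - b))"
  shows "f = g"
proof (rule poly_mapping_eqI)
  fix m
  show "Poly_Mapping.lookup f m = Poly_Mapping.lookup g m"
  proof (cases "m \<in> Poly_Mapping.keys f \<union> Poly_Mapping.keys g")
    case True
    then have "Poly_Mapping.keys m \<subseteq> {..<3}" "(\<Sum>i<3. Poly_Mapping.lookup m i) = d"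
      using assms(1,2) by (auto simp: forms_def)
    from eq_mono3I[OF this] assms(3) show ?thesis by blast
  next
    case False
    then show ?thesis by (simp add: in_keys_iff)
  qed
qed

lemma forms_add: "f \<in> forms n d \<Longrightarrow> g \<in> forms n d \<Longrightarrow> f + g \<in> forms n d"
  for f g :: "'k::comm_monoid_add mpoly"
  using keys_add[of f g] by (auto simp: forms_def)

lemma forms_sum: "(\<And>x. x \<in> A \<Longrightarrow> f x \<in> forms n d) \<Longrightarrow> (\<Sum>x\<in>A. f x) \<in> forms n d"
  for f :: "_ \<Rightarrow> 'k::comm_monoid_add mpoly"
  by (induction A rule: infinite_finite_induct) (simp_all add: forms_add, simp_all add: forms_def)

lemma single_mono3_in_forms: "a + b + c = d \<Longrightarrow> Poly_Mapping.single (mono3 a b c) x \<in> forms 3 d"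
  using keys_mono3 by (auto simp: forms_def sum_lookup_mono3)

lemma single_power: "Poly_Mapping.single (Poly_Mapping.single i 1) x ^ n =
    Poly_Mapping.single (Poly_Mapping.single i n) (x ^ n)"
  for x :: "'k::comm_ring_1" and i :: nat
proof (induction n)
  case (Suc n)
  then show ?case by (simp add: mult_single flip: single_add)
qed simp

lemma linear_form_power:
  fixes p q w :: "'k::comm_ring_1"
  shows "linear_form p q w ^ d = (\<Sum>a\<le>d. \<Sum>b\<le>d - a. Poly_Mapping.single (mono3 a b (d - a - b))
    (of_nat (d choose a) * of_nat ((d - a) choose b) * (p ^ a * q ^ b * w ^ (d - a - b))))"
proof -
  have of_nat: "of_nat n = Poly_Mapping.single 0 (of_nat n :: 'k)" for n by simp
  have "linear_form p q w ^ d = (\<Sum>a\<le>d. of_nat (d choose a) *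
      Poly_Mapping.single (Poly_Mapping.single 0 a) (p ^ a) *
      (\<Sum>b\<le>d - a. of_nat ((d - a) choose b) * Poly_Mapping.single (Poly_Mapping.single 1 b) (q ^ b) *
        Poly_Mapping.single (Poly_Mapping.single 2 (d - a - b)) (w ^ (d - a - b))))"
    by (simp only: linear_form_def binomial_ring single_power)
  also have "\<dots> = (\<Sum>a\<le>d. \<Sum>b\<le>d - a. Poly_Mapping.single (mono3 a b (d - a - b))
    (of_nat (d choose a) * of_nat ((d - a) choose b) * (p ^ a * q ^ b * w ^ (d - a - b))))"
    unfolding of_nat sum_distrib_left
    by (intro sum.cong refl) (simp only: mult_single mono3_def add_0_left ac_simps)
  finally show ?thesis .
qed

lemma linear_form_power_in_forms: "linear_form p q w ^ d \<in> forms 3 d"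
  unfolding linear_form_power by (intro forms_sum single_mono3_in_forms) auto

lemma lookup_linear_form_power:
  assumes "a + b + c = d"
  shows "Poly_Mapping.lookup (linear_form p q w ^ d) (mono3 a b c) =
    of_nat (d choose a) * of_nat ((d - a) choose b) * (p ^ a * q ^ b * w ^ c)"
proof -
  let ?f = "\<lambda>a b. of_nat (d choose a) * of_nat ((d - a) choose b) * (p ^ a * q ^ b * w ^ (d - a - b))"
  have "Poly_Mapping.lookup (linear_form p q w ^ d) (mono3 a b c) =
      (\<Sum>a'\<le>d. \<Sum>b'\<le>d - a'. if a' = a then if b' = b then ?f a b else 0 else 0)"
    unfolding linear_form_power lookup_sum using assms
    by (intro sum.cong refl) (auto simp: lookup_single when_def mono3_eq_iff)
  also have "\<dots> = (\<Sum>a'\<le>d. if a' = a then ?f a b else 0)"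
    using assms by (intro sum.cong refl) auto
  also have "\<dots> = ?f a b" using assms by simp
  also have "d - a - b = c" using assms by simp
  finally show ?thesis .
qed

lemma linear_form_in_forms: "linear_form p q w \<in> forms 3 1"
  using linear_form_power_in_forms[of p q w 1] by simp

lemma forms_1_eq_linear_form:
  assumes "l \<in> forms 3 1"
  shows "\<exists>p q w. l = linear_form p q w"
proof (intro exI)
  let ?c = "\<lambda>a b. Poly_Mapping.lookup l (mono3 a b (1 - a - b))"
  show "l = linear_form (?c 1 0) (?c 0 1) (?c 0 0)"
  proof (rule forms3_eqI[OF assms linear_form_in_forms])
    fix a b :: nat
    assume ab: "a + b \<le> 1"
    then have "a = 1 \<and> b = 0 \<or> a = 0 \<and> b = 1 \<or> a = 0 \<and> b = 0" by linarith
    then show "?c a b =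
        Poly_Mapping.lookup (linear_form (?c 1 0) (?c 0 1) (?c 0 0)) (mono3 a b (1 - a - b))"
      using lookup_linear_form_power[of a b "1 - a - b" 1 "?c 1 0" "?c 0 1" "?c 0 0"] by auto
  qed
qed

section \<open>Upper bound for the rank of ternary forms\<close>

lemma waring_decomposition_bound:
  fixes f :: "'k::{alg_closed_field,field_char_0} mpoly"
  assumes f: "f \<in> forms 3 d" and "d > 0"
  shows "\<exists>r l. 4 * r \<le> d\<^sup>2 + 11 * d + 4 \<and> (\<forall>i<r. l i \<in> forms 3 1) \<and> f = (\<Sum>i<r. l i ^ d)"
proof -
  \<comment> \<open>Dividing by the trinomial coefficients, nonzero in characteristic zero, turns
    the coefficients of \<open>f\<close> into moments. A point \<open>(u, v)\<close> stands for the
    linear form with coefficients \<open>u\<close>, \<open>v\<close>, \<open>1\<close>, and its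
    weight is absorbed as a \<open>d\<close>th root.\<close>
  define C :: "nat \<Rightarrow> nat \<Rightarrow> 'k" where
    "C a b = of_nat (d choose a) * of_nat ((d - a) choose b)" for a b
  have C: "C a b \<noteq> 0" if "a + b \<le> d" for a b
    using that by (simp add: C_def)
  define \<Phi> where "\<Phi> a b = Poly_Mapping.lookup f (mono3 a b (d - a - b)) / C a b" for a b
  from ex_power_moments[of d \<Phi>] obtain L where L: "4 * length L \<le> d\<^sup>2 + 11 * d + 4"
    and \<Phi>: "\<forall>a b. a + b \<le> d \<longrightarrow> \<Phi> a b = (\<Sum>(\<alpha>, u, v)\<leftarrow>L. \<alpha> * (u ^ a * v ^ b))"
    by (elim exE conjE)
  define root :: "'k \<Rightarrow> 'k" where "root \<alpha> = (SOME \<zeta>. \<zeta> ^ d = \<alpha>)" for \<alpha>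
  have root: "root \<alpha> ^ d = \<alpha>" for \<alpha>
    unfolding root_def using nth_root_exists[OF \<open>d > 0\<close>] by (rule someI_ex)
  define l where "l i = (case L ! i of (\<alpha>, u, v) \<Rightarrow>
    linear_form (root \<alpha> * u) (root \<alpha> * v) (root \<alpha>))" for i
  have "f = (\<Sum>i<length L. l i ^ d)"
  proof (rule forms3_eqI[OF f])
    show "(\<Sum>i<length L. l i ^ d) \<in> forms 3 d"
      by (intro forms_sum) (simp add: l_def linear_form_power_in_forms split: prod.split)
    fix a b assume ab: "a + b \<le> d"
    have "Poly_Mapping.lookup (l i ^ d) (mono3 a b (d - a - b)) =
        C a b * (case L ! i of (\<alpha>, u, v) \<Rightarrow> \<alpha> * (u ^ a * v ^ b))" for i
    proof -
      obtain \<alpha> u v where i: "L ! i = (\<alpha>, u, v)" by (cases "L ! i")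
      have e1: "root \<alpha> ^ a * root \<alpha> ^ b * root \<alpha> ^ (d - a - b) = root \<alpha> ^ d"
        using ab by (simp flip: power_add)
      have e2: "(root \<alpha> * u) ^ a * (root \<alpha> * v) ^ b * root \<alpha> ^ (d - a - b) =
          (root \<alpha> ^ a * root \<alpha> ^ b * root \<alpha> ^ (d - a - b)) * (u ^ a * v ^ b)"
        by (simp only: power_mult_distrib mult_ac)
      have e: "(root \<alpha> * u) ^ a * (root \<alpha> * v) ^ b * root \<alpha> ^ (d - a - b) =
          \<alpha> * (u ^ a * v ^ b)"
        by (simp only: e2 e1 root)
      have "a + b + (d - a - b) = d" using ab by simp
      then show ?thesis
        by (simp only: l_def i prod.case lookup_linear_form_power e C_def)
    qed
    then have "Poly_Mapping.lookup (\<Sum>i<length L. l i ^ d) (mono3 a b (d - a - b)) = C a b * \<Phi> a b"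
      using \<Phi> ab by (simp add: lookup_sum sum_distrib_left sum_list_sum_nth atLeast0LessThan)
    then show "Poly_Mapping.lookup f (mono3 a b (d - a - b)) =
        Poly_Mapping.lookup (\<Sum>i<length L. l i ^ d) (mono3 a b (d - a - b))"
      using C[OF ab] by (simp add: \<Phi>_def)
  qed
  moreover have "l i \<in> forms 3 1" for i
    by (simp only: l_def linear_form_in_forms split: prod.split) simp
  ultimately show ?thesis
    using L by (intro exI[of _ "length L"] exI[of _ l] conjI allI impI)
qed

section \<open>Lower bound for the rank of monomials\<close>

lemma ex_nontrivial_solution:
  fixes g :: "nat \<Rightarrow> 'x \<Rightarrow> 'k::field"
  assumes "finite X" "r < card X"
  shows "\<exists>h. (\<exists>x\<in>X. h x \<noteq> 0) \<and> (\<forall>t<r. (\<Sum>x\<in>X. g t x * h x) = 0)"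
  using assms
proof (induction r arbitrary: X g)
  case 0
  then have "X \<noteq> {}" by auto
  then show ?case by (intro exI[of _ "\<lambda>_. 1"]) auto
next
  case (Suc r)
  show ?case
  proof (cases "\<exists>y\<in>X. g r y \<noteq> 0")
    case False
    obtain h where h: "\<exists>x\<in>X. h x \<noteq> 0" "\<And>t. t < r \<Longrightarrow> (\<Sum>x\<in>X. g t x * h x) = 0"
      using Suc.IH[of X g] Suc.prems by auto
    moreover have "(\<Sum>x\<in>X. g r x * h x) = 0" using False by simp
    ultimately show ?thesis by (auto simp: less_Suc_eq)
  next
    case True
    then obtain y where y: "y \<in> X" "g r y \<noteq> 0" by blast
    \<comment> \<open>Gaussian elimination: equation \<open>r\<close> is solved for the unknown at
      \<open>y\<close>.\<close>
    define X' where "X' = X - {y}"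
    have X: "X = insert y X'" "y \<notin> X'" "finite X'" "r < card X'"
      using y(1) Suc.prems by (auto simp: X'_def)
    obtain h where h: "\<exists>x\<in>X'. h x \<noteq> 0"
      "\<And>t. t < r \<Longrightarrow> (\<Sum>x\<in>X'. (g t x - g t y / g r y * g r x) * h x) = 0"
      using Suc.IH[of X' "\<lambda>t x. g t x - g t y / g r y * g r x"] X(3,4) by auto
    define h' where "h' = h(y := - (\<Sum>x\<in>X'. g r x * h x) / g r y)"
    have h': "(\<Sum>x\<in>X. g t x * h' x) = (\<Sum>x\<in>X'. g t x * h x) - g t y / g r y * (\<Sum>x\<in>X'. g r x * h x)" for t
    proof -
      have "(\<Sum>x\<in>X'. g t x * h' x) = (\<Sum>x\<in>X'. g t x * h x)"
        using X(2) by (intro sum.cong) (auto simp: h'_def)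
      then show ?thesis using X by (simp add: h'_def)
    qed
    have "(\<Sum>x\<in>X. g t x * h' x) = 0" if "t < Suc r" for t
    proof (cases "t = r")
      case True
      then show ?thesis using y h' by simp
    next
      case False
      then have "(\<Sum>x\<in>X'. (g t x - g t y / g r y * g r x) * h x) = 0"
        using that by (intro h(2)) simp
      then show ?thesis
        by (simp add: h' left_diff_distrib sum_subtractf sum_distrib_left mult.assoc)
    qed
    moreover have "\<exists>x\<in>X. h' x \<noteq> 0" using h(1) X(1,2) by (auto simp: h'_def)
    ultimately show ?thesis by blast
  qed
qed

lemma monomial_rank_lower_bound:
  fixes l :: "nat \<Rightarrow> 'k::field_char_0 mpoly"
  assumes l: "\<And>i. i < r \<Longrightarrow> l i \<in> forms 3 1"
    and eq: "Poly_Mapping.single (mono3 1 b c) 1 = (\<Sum>i<r. l i ^ Suc (b + c))"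
  shows "(b + 1) * (c + 1) \<le> r"
proof (rule ccontr)
  assume "\<not> (b + 1) * (c + 1) \<le> r"
  then have r: "r < card ({..b} \<times> {..c})" by (simp add: card_cartesian_product)
  define d where "d = Suc (b + c)"
  have "\<forall>i. \<exists>p q w. i < r \<longrightarrow> l i = linear_form p q w"
    using forms_1_eq_linear_form[OF l] by blast
  then obtain p q w where lin: "\<And>i. i < r \<Longrightarrow> l i = linear_form (p i) (q i) (w i)"
    by metis
  \<comment> \<open>Up to the nonzero factors \<open>C\<close> these power sums are the coefficients
    of the monomial, so for \<open>i + j \<le> b + c\<close> only \<open>M b c\<close> is
    nonzero.\<close>
  define M where "M i j = (\<Sum>t<r. p t ^ (d - i - j) * q t ^ i * w t ^ j)" for i j
  have M: "M i j \<noteq> 0 \<longleftrightarrow> i = b \<and> j = c" if "i + j \<le> b + c" for i j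
  proof -
    define C :: 'k where "C = of_nat (d choose (d - i - j)) * of_nat ((d - (d - i - j)) choose i)"
    have "C \<noteq> 0" using that by (simp add: C_def d_def)
    have d: "d - i - j + i + j = d" using that by (simp add: d_def)
    have "Poly_Mapping.lookup (\<Sum>t<r. l t ^ d) (mono3 (d - i - j) i j) = C * M i j"
      unfolding lookup_sum M_def sum_distrib_left
      by (intro sum.cong refl) (simp only: lessThan_iff lin lookup_linear_form_power[OF d] C_def)
    moreover have "Poly_Mapping.lookup (\<Sum>t<r. l t ^ d) (mono3 (d - i - j) i j) =
        (if i = b \<and> j = c then 1 else 0)"
      using that unfolding d_def eq[symmetric]
      by (auto simp: lookup_single when_def mono3_eq_iff)
    ultimately show ?thesis using \<open>C \<noteq> 0\<close> by (auto split: if_splits)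
  qed
  define X where "X = {..b} \<times> {..c}"
  \<comment> \<open>Evaluation of monomials in the affine chart; points with \<open>p t = 0\<close>
    impose no condition on \<open>h\<close>.\<close>
  define g where "g t x = (if p t = 0 then 0 else (q t / p t) ^ fst x * (w t / p t) ^ snd x)"
    for t and x :: "nat \<times> nat"
  obtain h where h: "\<exists>x\<in>X. h x \<noteq> 0" "\<And>t. t < r \<Longrightarrow> (\<Sum>x\<in>X. g t x * h x) = 0"
    using ex_nontrivial_solution[of X r g] r by (auto simp: X_def)
  define A where "A = {x \<in> X. h x \<noteq> 0}"
  have A: "finite A" "A \<noteq> {}" using h(1) by (auto simp: A_def X_def)
  define e where "e = Max ((\<lambda>x. fst x + snd x) ` A)"
  have "e \<in> (\<lambda>x. fst x + snd x) ` A" unfolding e_def using A by (intro Max_in) auto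
  then obtain i j where ij: "(i, j) \<in> A" "e = i + j" by auto
  have max: "i' + j' \<le> i + j" if "(i', j') \<in> A" for i' j'
  proof -
    have "fst (i', j') + snd (i', j') \<le> e"
      unfolding e_def using A that by (intro Max_ge) (auto intro: rev_image_eqI)
    then show ?thesis using ij(2) by simp
  qed
  have le: "i \<le> b" "j \<le> c" using ij(1) by (auto simp: A_def X_def)
  \<comment> \<open>Multiplication by the monomial \<open>(b - i, c - j)\<close> sends the top
    degree term \<open>(i, j)\<close> to \<open>(b, c)\<close> and keeps all degrees at most
    \<open>b + c\<close>.\<close>
  have "(\<Sum>x\<in>A. h x * M (fst x + (b - i)) (snd x + (c - j))) =
      (\<Sum>t<r. p t ^ d * g t (b - i, c - j) * (\<Sum>x\<in>X. g t x * h x))"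
  proof -
    have "p t ^ (d - (fst x + (b - i)) - (snd x + (c - j))) * q t ^ (fst x + (b - i)) *
        w t ^ (snd x + (c - j)) = p t ^ d * g t (b - i, c - j) * g t x" if "x \<in> A" for t x
    proof -
      let ?m = "fst x + (b - i)" and ?n = "snd x + (c - j)"
      have mn: "?m + ?n \<le> b + c" using max[of "fst x" "snd x"] that le by simp
      \<comment> \<open>As \<open>b + c = d - 1\<close>, the exponent of \<open>p t\<close> stays
        positive, so points with \<open>p t = 0\<close> contribute nothing to either side.\<close>
      then have "d - ?m - ?n > 0" by (simp add: d_def)
      moreover have "p t ^ d = p t ^ (d - ?m - ?n) * (p t ^ ?m * p t ^ ?n)"
      proof -
        have "d = (d - ?m - ?n) + (?m + ?n)" using mn by (simp add: d_def)
        then show ?thesis by (metis power_add)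
      qed
      ultimately show ?thesis
        by (cases "p t = 0") (simp_all add: g_def power_add power_divide)
    qed
    then have "(\<Sum>x\<in>A. h x * M (fst x + (b - i)) (snd x + (c - j))) =
        (\<Sum>x\<in>A. h x * (\<Sum>t<r. p t ^ d * g t (b - i, c - j) * g t x))"
      by (intro sum.cong refl) (simp add: M_def)
    also have "\<dots> = (\<Sum>t<r. \<Sum>x\<in>A. h x * (p t ^ d * g t (b - i, c - j) * g t x))"
      unfolding sum_distrib_left by (rule sum.swap)
    also have "\<dots> = (\<Sum>t<r. p t ^ d * g t (b - i, c - j) * (\<Sum>x\<in>A. g t x * h x))"
      unfolding sum_distrib_left by (simp only: mult_ac)
    moreover have "(\<Sum>x\<in>A. g t x * h x) = (\<Sum>x\<in>X. g t x * h x)" for t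
      by (intro sum.mono_neutral_left) (auto simp: A_def X_def)
    ultimately show ?thesis by simp
  qed
  also have "\<dots> = 0" using h(2) by simp
  \<comment> \<open>Only \<open>(i, j)\<close> is shifted to \<open>(b, c)\<close>, and
    \<open>M\<close> vanishes at the other shifted exponents.\<close>
  also have "(\<Sum>x\<in>A. h x * M (fst x + (b - i)) (snd x + (c - j))) =
      (\<Sum>x\<in>A. if x = (i, j) then h x * M b c else 0)"
  proof (intro sum.cong refl)
    fix x assume x: "x \<in> A"
    have "fst x + (b - i) + (snd x + (c - j)) \<le> b + c"
      using max[of "fst x" "snd x"] x le by simp
    from M[OF this] show "h x * M (fst x + (b - i)) (snd x + (c - j)) =
        (if x = (i, j) then h x * M b c else 0)"
      using le by (cases x) auto
  qed
  also have "\<dots> = h (i, j) * M b c" using ij(1) A(1) by simp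
  finally show False using ij(1) M[of b c] by (simp add: A_def)
qed

theorem proposition3p4:
  shows "(\<lambda>d. real (r_max TYPE('k::{alg_closed_field, field_char_0}) 3 d) - (real d)\<^sup>2 / 4)
           \<in> O[at_top](\<lambda>d. real d)"
\<comment> \<open>Four times the difference lies between \<open>0\<close> and
  \<open>11 * d + 4\<close>, which is at most \<open>16 * d\<close> for
  \<open>d > 0\<close>.\<close>
proof (rule bigoI[of _ 4])
  let ?F = "\<lambda>d. forms 3 d :: 'k mpoly set"
  have "norm (real (r_max TYPE('k) 3 d) - (real d)\<^sup>2 / 4) \<le> 4 * norm (real d)" if d: "d > 0" for d
  proof -
    have rank: "4 * waring_rank 3 d f \<le> d\<^sup>2 + 11 * d + 4"
      "\<exists>l. (\<forall>i<waring_rank 3 d f. l i \<in> forms 3 1) \<and> f = (\<Sum>i<waring_rank 3 d f. l i ^ d)"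
      if f: "f \<in> ?F d" for f
    proof -
      obtain r where r: "4 * r \<le> d\<^sup>2 + 11 * d + 4"
        "\<exists>l. (\<forall>i<r. l i \<in> forms 3 1) \<and> f = (\<Sum>i<r. l i ^ d)"
        using waring_decomposition_bound[OF f d] by blast
      have "waring_rank 3 d f \<le> r" unfolding waring_rank_def by (rule Least_le) (rule r(2))
      then show "4 * waring_rank 3 d f \<le> d\<^sup>2 + 11 * d + 4" using r(1) by simp
      show "\<exists>l. (\<forall>i<waring_rank 3 d f. l i \<in> forms 3 1) \<and> f = (\<Sum>i<waring_rank 3 d f. l i ^ d)"
        unfolding waring_rank_def by (rule LeastI) (rule r(2))
    qed
    \<comment> \<open>The ranks are bounded, hence a finite set, and \<open>Max\<close> is a genuine
      maximum.\<close>
    have "waring_rank 3 d ` ?F d \<subseteq> {..d\<^sup>2 + 11 * d + 4}"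
    proof (intro image_subsetI)
      show "waring_rank 3 d f \<in> {..d\<^sup>2 + 11 * d + 4}" if "f \<in> ?F d" for f
        using rank(1)[OF that] by simp
    qed
    then have fin: "finite (waring_rank 3 d ` ?F d)" by (rule finite_subset) simp
    have "0 \<in> ?F d" by (simp add: forms_def)
    then have "r_max TYPE('k) 3 d \<in> waring_rank 3 d ` ?F d"
      unfolding r_max_def using fin by (intro Max_in) auto
    then have upper: "4 * r_max TYPE('k) 3 d \<le> d\<^sup>2 + 11 * d + 4" using rank(1) by auto
    \<comment> \<open>Among \<open>b + c = d - 1\<close> the balanced choice maximizes
      \<open>(b + 1) * (c + 1)\<close>, which is then at least \<open>d\<^sup>2 / 4\<close>.\<close>
    define b c where "b = (d - 1) div 2" and "c = d - 1 - b"
    have bc: "d = Suc (b + c)" using d by (simp add: b_def c_def)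
    have cb: "c = b \<or> c = b + 1" unfolding b_def c_def by linarith
    let ?f = "Poly_Mapping.single (mono3 1 b c) (1::'k)"
    have f: "?f \<in> ?F d" by (rule single_mono3_in_forms) (simp add: bc)
    have "(b + 1) * (c + 1) \<le> waring_rank 3 d ?f"
      using rank(2)[OF f] monomial_rank_lower_bound[of "waring_rank 3 d ?f" _ b c]
      unfolding bc by blast
    also have "\<dots> \<le> r_max TYPE('k) 3 d"
      unfolding r_max_def using fin f by (intro Max_ge) auto
    finally have "(b + 1) * (c + 1) \<le> r_max TYPE('k) 3 d" .
    moreover have "d\<^sup>2 \<le> 4 * ((b + 1) * (c + 1))"
      using cb by (auto simp: bc power2_eq_square algebra_simps)
    ultimately have lower: "d\<^sup>2 \<le> 4 * r_max TYPE('k) 3 d" by linarith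
    have "(real d)\<^sup>2 \<le> 4 * real (r_max TYPE('k) 3 d)"
      using of_nat_mono[OF lower, where ?'a = real] by simp
    moreover have "4 * real (r_max TYPE('k) 3 d) \<le> (real d)\<^sup>2 + 11 * real d + 4"
      using of_nat_mono[OF upper, where ?'a = real] by simp
    moreover have "real d \<ge> 1" using d by simp
    ultimately show ?thesis by simp
  qed
  then show "\<forall>\<^sub>F d in at_top. norm (real (r_max TYPE('k) 3 d) - (real d)\<^sup>2 / 4) \<le> 4 * norm (real d)"
    using eventually_gt_at_top[of 0] by (rule eventually_mono[rotated])
qed

end
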